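(* Let $M$ be a connected $C^1$-Fréchet manifold endowed with a Finsler structure on $TM$ whose associated Finsler metric $\rho$ is complete. Let $x_0,x_1\in M$ and let $U\subset M$ be open with $x_0\in U$ and $x_1\notin\overline{U}$. Let $\varphi: M\to\mathbb{R}$ be a non-constant closed $C^1$-functional satisfying the following conditions: (1) $\max\{\varphi(x_0),\varphi(x_1)\}\le \inf_{x\in\partial U}\varphi(x) =: \mathbf{i}$; (2) $\varphi$ satisfies the Palais-Smale condition on $M$ at the level $$c := \inf_{h\in\mathcal{C}}\ \sup_{t\in[0,1]}\varphi(h(t)),$$ where $\mathcal{C} := \{h:[0,1]\to M \mid h \text{ continuous},\ h(0)=x_0,\ h(1)=x_1\}$. Then $c$ is a critical value of $\varphi$ and $c\ge\mathbf{i}$. If $c=\mathbf{i}$, then $\mathrm{Cr}(\varphi,c)\cap\partial U\neq\varnothing$.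
   Context: Keller $C^1$ maps: for Fréchet spaces $E,F$, a continuous map $f: U \to F$ on an open $U\subset E$ is $C^1$ if the directional derivatives $\mathrm{D}f(x)h = \lim_{t\to 0} (f(x+th)-f(x))/t$ exist for all $x\in U$, $h \in E$, and $x \mapsto \mathrm{D}f(x)$ is a continuous map from $U$ into the space $L(E,F)$ of continuous linear maps with the compact-open topology (uniform convergence on compact sets). A $C^1$-Fréchet manifold is a Hausdorff second countable manifold modeled on a Fréchet space $F$, with an atlas whose transition functions are all Keller $C^1$. A $C^1$-functional is a real-valued function of class $C^1$ in this sense (in charts). A map is closed if it maps closed sets to closed sets. Finsler structure: a Finsler structure on a trivial bundle $V = T\times F$ ($T$ a topological space, $F$ a Fréchet space) is a collection of continuous functions $\|\cdot\|_{V,n}: V\to \mathbb{R}^+$ (nonnegative values), $n\in\mathbb{N}$, such that (F1) for each fixed $b\in T$, $\|x\|^b_{F,n} := \|(b,x)\|_{V,n}$ is a collection of seminorms on $F$ giving the topology of $F$; (F2) for every $k>1$ and $x_0 \in T$ there is a neighborhood $W$ of $x_0$ with $\frac1k \|x\|^{x_0}_{F,n} \le \|x\|^{w}_{F,n}\le k\|x\|^{x_0}_{F,n}$ for all $w\in W$, $n \in\mathbb{N}$, $x\in F$. A Finsler structure for $TM$ is a collection of continuous functions $\|\cdot\|_{M,n}: TM\to\mathbb{R}^+$ such that around each point there is a bundle chart $\psi: U\times F\simeq TM|_U$ through which they become a Finsler structure for $U\times F$. We take it graded: $\|\cdot\|_{M,n}\le \|\cdot\|_{M,n+1}$ for all $n$.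 The length of a piecewise $C^1$ curve $g:[a,b]\to M$ with respect to the $n$-th component is $L_n(g)=\int_a^b \|g'(t)\|_{M,n}^{g(t)}\,dt$; $\rho_n(x,y)$ is the infimum of $L_n$ over piecewise $C^1$ curves connecting $x$ to $y$; the Finsler metric is $\rho(x,y)=\sum_{n\ge1} 2^{-n}\frac{\rho_n(x,y)}{1+\rho_n(x,y)}$, which induces the topology of $M$. Critical points: for $x\in M$, $h\in T_xM$ and a chart $(x\in U,\psi)$ with induced map $\psi_*(x):T_xM\to F$, $\varphi'(x,h)=\lim_{t\to0}\big(\varphi(\psi^{-1}(\psi(x)+t\psi_*(x)(h)))-\varphi(x)\big)/t$. A point $x$ is critical for $\varphi$ if $(\varphi\circ\psi^{-1})'(\psi(x))=0$ for one (hence every) chart $\psi$ at $x$; $\mathrm{Cr}(\varphi,c)$ is the set of critical points $x$ with $\varphi(x)=c$; $c$ is a critical value if $\mathrm{Cr}(\varphi,c)\ne\varnothing$. Palais-Smale condition: let $B_\infty(0_x) = \bigcap_{n\ge1}\{h\in T_xM : \|h\|^x_{M,n}\le 1\}$ and $\Phi_\varphi(x)=\inf\{\varphi'(x,h): h\in B_\infty(0_x)\}$. The functional $\varphi$ satisfies the Palais-Smale condition at level $c\in\mathbb{R}$ in a set $A\subset M$ if every sequence $(m_i)\subset A$ with $\varphi(m_i)\to c$ and $\Phi_\varphi(m_i)\to 0$ has a convergent subsequence; "on $M$" means $A=M$. *)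

theory Defs
  imports "HOL-Analysis.Analysis"
begin

section \<open>Frechet spaces and Keller's differentiability class\<close>

definition (in real_vector) seminorm :: "('a \<Rightarrow> real) \<Rightarrow> bool" where
  "seminorm p \<longleftrightarrow>
     (\<forall>x. 0 \<le> p x) \<and> (\<forall>r x. p (r *\<^sub>R x) = \<bar>r\<bar> * p x) \<and> (\<forall>x y. p (x + y) \<le> p x + p y)"

class real_vector_t2 = real_vector + t2_space
begin

definition seminorms_give_topology :: "(nat \<Rightarrow> 'a \<Rightarrow> real) \<Rightarrow> bool" where
  "seminorms_give_topology p \<longleftrightarrow>
     (\<forall>n. seminorm (p n)) \<and>
     (\<forall>S. open S \<longleftrightarrow>
        (\<forall>x\<in>S. \<exists>I e. finite I \<and> e > 0 \<and> {y. \<forall>n\<in>I. p n (y - x) < e} \<subseteq> S))"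

end

class frechet_space = real_vector_t2 +
  assumes frechet_ex: "\<exists>p::nat \<Rightarrow> 'a \<Rightarrow> real.
      seminorms_give_topology p \<and>
      (\<forall>X::nat \<Rightarrow> 'a. (\<forall>n. \<forall>e>0. \<exists>k. \<forall>i\<ge>k. \<forall>j\<ge>k. p n (X i - X j) < e)
         \<longrightarrow> (\<exists>l. X \<longlonglongrightarrow> l))"

instance real :: real_vector_t2 ..

instance real :: frechet_space
proof
  let ?p = "\<lambda>(n::nat) (x::real). \<bar>x\<bar>"
  have "seminorms_give_topology ?p"
    unfolding seminorms_give_topology_def
  proof (intro conjI allI)
    show "seminorm (?p n)" for n
      by (auto simp: seminorm_def abs_mult)
    fix S :: "real set"
    show "open S \<longleftrightarrow>
        (\<forall>x\<in>S. \<exists>I e. finite I \<and> e > 0 \<and> {y. \<forall>n\<in>I. ?p n (y - x) < e} \<subseteq> S)" (is "_ \<longleftrightarrow> ?R")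
    proof
      assume "open S"
      show ?R
      proof
        fix x assume "x \<in> S"
        then obtain e where "e > 0" "\<forall>y. dist y x < e \<longrightarrow> y \<in> S"
          using \<open>open S\<close> by (auto simp: open_dist)
        then show "\<exists>I e. finite I \<and> e > 0 \<and> {y. \<forall>n\<in>I. ?p n (y - x) < e} \<subseteq> S"
          by (intro exI[of _ "{0}"] exI[of _ e]) (auto simp: dist_real_def)
      qed
    next
      assume R: ?R
      show "open S"
        unfolding open_dist
      proof
        fix x assume "x \<in> S"
        with R obtain I e where "e > 0" "{y. \<forall>n\<in>(I::nat set). \<bar>y - x\<bar> < e} \<subseteq> S"
          by blast
        then show "\<exists>e>0. \<forall>y. dist y x < e \<longrightarrow> y \<in> S"
          by (intro exI[of _ e]) (auto simp: dist_real_def)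
      qed
    qed
  qed
  moreover have "\<exists>l. X \<longlonglongrightarrow> l"
    if "\<forall>n. \<forall>e>0. \<exists>k. \<forall>i\<ge>k. \<forall>j\<ge>k. ?p n (X i - X j) < e" for X :: "nat \<Rightarrow> real"
  proof -
    have "Cauchy X"
      using that by (auto simp: Cauchy_def dist_real_def)
    then show ?thesis
      by (simp add: Cauchy_convergent_iff convergent_def)
  qed
  ultimately show "\<exists>p::nat \<Rightarrow> real \<Rightarrow> real. seminorms_give_topology p \<and>
      (\<forall>X::nat \<Rightarrow> real. (\<forall>n. \<forall>e>0. \<exists>k. \<forall>i\<ge>k. \<forall>j\<ge>k. p n (X i - X j) < e)
         \<longrightarrow> (\<exists>l. X \<longlonglongrightarrow> l))"
    by blast
qed

definition has_dir_deriv ::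
  "('e::frechet_space \<Rightarrow> 'f::frechet_space) \<Rightarrow> 'e \<Rightarrow> 'e \<Rightarrow> 'f \<Rightarrow> bool" where
  "has_dir_deriv f x h d \<longleftrightarrow> ((\<lambda>t::real. (f (x + t *\<^sub>R h) - f x) /\<^sub>R t) \<longlongrightarrow> d) (at 0)"

definition dir_deriv ::
  "('e::frechet_space \<Rightarrow> 'f::frechet_space) \<Rightarrow> 'e \<Rightarrow> 'e \<Rightarrow> 'f" where
  "dir_deriv f x h = (THE d. has_dir_deriv f x h d)"

definition continuous_linear_maps :: "('e::frechet_space \<Rightarrow> 'f::frechet_space) set" where
  "continuous_linear_maps = {L. linear L \<and> continuous_on UNIV L}"

definition compact_open_topology :: "('e::frechet_space \<Rightarrow> 'f::frechet_space) topology" where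
  "compact_open_topology = topology_generated_by
     {{L \<in> continuous_linear_maps. L ` K \<subseteq> W} | K W. compact K \<and> open W}"

definition keller_C1_on :: "'e set \<Rightarrow> ('e::frechet_space \<Rightarrow> 'f::frechet_space) \<Rightarrow> bool" where
  "keller_C1_on U f \<longleftrightarrow>
     open U \<and> continuous_on U f \<and>
     (\<forall>x\<in>U. \<forall>h. \<exists>d. has_dir_deriv f x h d) \<and>
     continuous_map (top_of_set U) compact_open_topology (dir_deriv f)"


section \<open>Frechet manifolds and their tangent bundles\<close>

text \<open>
  The manifold is the whole type \<open>'m\<close>, of class \<open>t2_space\<close> and
  \<open>second_countable_topology\<close>. A chart \<open>(U, \<psi>)\<close> carries its domain; the values of
  \<open>\<psi>\<close> outside \<open>U\<close> play no role.
\<close>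

type_synonym ('m, 'f) chart = "'m set \<times> ('m \<Rightarrow> 'f)"

definition chart_inv :: "('m, 'f) chart \<Rightarrow> 'f \<Rightarrow> 'm" where
  "chart_inv c = inv_into (fst c) (snd c)"

definition is_chart :: "('m::topological_space, 'f::frechet_space) chart \<Rightarrow> bool" where
  "is_chart c \<longleftrightarrow>
     open (fst c) \<and> open (snd c ` fst c) \<and>
     homeomorphism (fst c) (snd c ` fst c) (snd c) (chart_inv c)"

definition transition :: "('m, 'f) chart \<Rightarrow> ('m, 'f) chart \<Rightarrow> 'f \<Rightarrow> 'f" where
  "transition c d = snd d \<circ> chart_inv c"

definition C1_transition :: "('m, 'f::frechet_space) chart \<Rightarrow> ('m, 'f) chart \<Rightarrow> bool" where
  "C1_transition c d \<longleftrightarrow> keller_C1_on (snd c ` (fst c \<inter> fst d)) (transition c d)"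

definition C1_atlas :: "('m::topological_space, 'f::frechet_space) chart set \<Rightarrow> bool" where
  "C1_atlas \<A> \<longleftrightarrow>
     (\<forall>c\<in>\<A>. is_chart c) \<and> (\<Union>c\<in>\<A>. fst c) = UNIV \<and>
     (\<forall>c\<in>\<A>. \<forall>d\<in>\<A>. C1_transition c d)"

text \<open>The maximal atlas, i.e.\ all charts of the \<open>C\<^sup>1\<close>-structure determined by \<open>\<A>\<close>.\<close>

definition charts ::
  "('m::topological_space, 'f::frechet_space) chart set \<Rightarrow> ('m, 'f) chart set" where
  "charts \<A> = {c. is_chart c \<and> (\<forall>d\<in>\<A>. C1_transition c d \<and> C1_transition d c)}"

definition charts_at ::
  "('m::topological_space, 'f::frechet_space) chart set \<Rightarrow> 'm \<Rightarrow> ('m, 'f) chart set" where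
  "charts_at \<A> x = {c \<in> charts \<A>. x \<in> fst c}"

text \<open>
  A tangent vector at \<open>x\<close> is an equivalence class of pairs \<open>(c, u)\<close>, with \<open>c\<close> a chart at
  \<open>x\<close> and \<open>u\<close> the coordinate vector in that chart.
\<close>

type_synonym ('m, 'f) tvec = "(('m, 'f) chart \<times> 'f) set"

definition tangent_rel ::
  "('m::topological_space, 'f::frechet_space) chart set \<Rightarrow> 'm \<Rightarrow>
     ((('m, 'f) chart \<times> 'f) \<times> (('m, 'f) chart \<times> 'f)) set" where
  "tangent_rel \<A> x = {((c, u), (d, v)) | c u d v.
     c \<in> charts_at \<A> x \<and> d \<in> charts_at \<A> x \<and> v = dir_deriv (transition c d) (snd c x) u}"

definition tangent_space ::
  "('m::topological_space, 'f::frechet_space) chart set \<Rightarrow> 'm \<Rightarrow> ('m, 'f) tvec set" where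
  "tangent_space \<A> x = (charts_at \<A> x \<times> UNIV) // tangent_rel \<A> x"

text \<open>The induced isomorphism \<open>\<psi>\<^sub>*(x)\<close> from the tangent space to the model space.\<close>

definition chart_push :: "('m, 'f) chart \<Rightarrow> ('m, 'f) tvec \<Rightarrow> 'f" where
  "chart_push c v = (THE u. (c, u) \<in> v)"

definition tangent_bundle ::
  "('m::topological_space, 'f::frechet_space) chart set \<Rightarrow> ('m \<times> ('m, 'f) tvec) set" where
  "tangent_bundle \<A> = Sigma UNIV (tangent_space \<A>)"

text \<open>The bundle chart over \<open>U\<close> induced by a chart \<open>(U, \<psi>)\<close>.\<close>

definition bundle_chart ::
  "('m::topological_space, 'f::frechet_space) chart set \<Rightarrow> ('m, 'f) chart \<Rightarrow>
     'm \<times> 'f \<Rightarrow> 'm \<times> ('m, 'f) tvec" where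
  "bundle_chart \<A> c = (\<lambda>(y, u). (y, tangent_rel \<A> y `` {(c, u)}))"

definition tangent_topology ::
  "('m::topological_space, 'f::frechet_space) chart set \<Rightarrow> ('m \<times> ('m, 'f) tvec) topology" where
  "tangent_topology \<A> = topology_generated_by
     {bundle_chart \<A> c ` S | c S. c \<in> charts \<A> \<and> open S \<and> S \<subseteq> fst c \<times> UNIV}"


section \<open>Finsler structures\<close>

text \<open>
  The seminorms are indexed by \<open>nat\<close> from \<open>0\<close>: \<open>N n\<close> is the seminorm usually numbered
  \<open>n + 1\<close>.
\<close>

definition finsler_trivial ::
  "'b topology \<Rightarrow> (nat \<Rightarrow> 'b \<times> 'f::frechet_space \<Rightarrow> real) \<Rightarrow> bool" where
  "finsler_trivial T N \<longleftrightarrow>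
     (\<forall>n. continuous_map (prod_topology T euclidean) euclideanreal (N n)) \<and>
     (\<forall>n. \<forall>b\<in>topspace T. \<forall>x. 0 \<le> N n (b, x)) \<and>
     (\<forall>b\<in>topspace T. seminorms_give_topology (\<lambda>n x. N n (b, x))) \<and>
     (\<forall>k>1. \<forall>x0\<in>topspace T. \<exists>W. openin T W \<and> x0 \<in> W \<and>
        (\<forall>w\<in>W. \<forall>n x. 1 / k * N n (x0, x) \<le> N n (w, x) \<and> N n (w, x) \<le> k * N n (x0, x)))"

definition finsler_structure ::
  "('m::topological_space, 'f::frechet_space) chart set \<Rightarrow>
     (nat \<Rightarrow> 'm \<times> ('m, 'f) tvec \<Rightarrow> real) \<Rightarrow> bool" where
  "finsler_structure \<A> N \<longleftrightarrow>
     (\<forall>n. continuous_map (tangent_topology \<A>) euclideanreal (N n)) \<and>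
     (\<forall>n. \<forall>v\<in>tangent_bundle \<A>. 0 \<le> N n v) \<and>
     (\<forall>x. \<exists>c\<in>charts_at \<A> x.
        finsler_trivial (top_of_set (fst c)) (\<lambda>n. N n \<circ> bundle_chart \<A> c)) \<and>
     (\<forall>n. \<forall>v\<in>tangent_bundle \<A>. N n v \<le> N (Suc n) v)"

definition has_velocity ::
  "('m::topological_space, 'f::frechet_space) chart set \<Rightarrow> (real \<Rightarrow> 'm) \<Rightarrow> real set \<Rightarrow> real \<Rightarrow>
     ('m, 'f) tvec \<Rightarrow> bool" where
  "has_velocity \<A> g S t v \<longleftrightarrow>
     v \<in> tangent_space \<A> (g t) \<and>
     (\<forall>c\<in>charts_at \<A> (g t).
        ((\<lambda>s. (snd c (g s) - snd c (g t)) /\<^sub>R (s - t)) \<longlongrightarrow> chart_push c v) (at t within S))"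

definition velocity ::
  "('m::topological_space, 'f::frechet_space) chart set \<Rightarrow> (real \<Rightarrow> 'm) \<Rightarrow> real set \<Rightarrow> real \<Rightarrow>
     ('m, 'f) tvec" where
  "velocity \<A> g S t = (THE v. has_velocity \<A> g S t v)"

definition C1_curve_on ::
  "('m::topological_space, 'f::frechet_space) chart set \<Rightarrow> real set \<Rightarrow> (real \<Rightarrow> 'm) \<Rightarrow> bool" where
  "C1_curve_on \<A> S g \<longleftrightarrow>
     continuous_on S g \<and> (\<forall>t\<in>S. \<exists>v. has_velocity \<A> g S t v) \<and>
     continuous_map (top_of_set S) (tangent_topology \<A>) (\<lambda>t. (g t, velocity \<A> g S t))"

definition piecewise_C1_curve ::
  "('m::topological_space, 'f::frechet_space) chart set \<Rightarrow> real \<Rightarrow> real \<Rightarrow> (real \<Rightarrow> 'm) \<Rightarrow> bool"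
  where
  "piecewise_C1_curve \<A> a b g \<longleftrightarrow>
     a < b \<and> continuous_on {a..b} g \<and>
     (\<exists>P. finite P \<and> P \<subseteq> {a..b} \<and> a \<in> P \<and> b \<in> P \<and>
        (\<forall>s\<in>P. \<forall>t\<in>P. s < t \<and> P \<inter> {s<..<t} = {} \<longrightarrow> C1_curve_on \<A> {s..t} g))"

text \<open>At the finitely many break points the velocity is unspecified.\<close>

definition curve_length ::
  "('m::topological_space, 'f::frechet_space) chart set \<Rightarrow>
     (nat \<Rightarrow> 'm \<times> ('m, 'f) tvec \<Rightarrow> real) \<Rightarrow> nat \<Rightarrow> real \<Rightarrow> real \<Rightarrow> (real \<Rightarrow> 'm) \<Rightarrow> real" where
  "curve_length \<A> N n a b g = integral {a..b} (\<lambda>t. N n (g t, velocity \<A> g {a..b} t))"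

definition finsler_pseudodist ::
  "('m::topological_space, 'f::frechet_space) chart set \<Rightarrow>
     (nat \<Rightarrow> 'm \<times> ('m, 'f) tvec \<Rightarrow> real) \<Rightarrow> nat \<Rightarrow> 'm \<Rightarrow> 'm \<Rightarrow> real" where
  "finsler_pseudodist \<A> N n x y =
     Inf {curve_length \<A> N n a b g | a b g. piecewise_C1_curve \<A> a b g \<and> g a = x \<and> g b = y}"

definition finsler_metric ::
  "('m::topological_space, 'f::frechet_space) chart set \<Rightarrow>
     (nat \<Rightarrow> 'm \<times> ('m, 'f) tvec \<Rightarrow> real) \<Rightarrow> 'm \<Rightarrow> 'm \<Rightarrow> real" where
  "finsler_metric \<A> N x y =
     (\<Sum>n. (1/2) ^ Suc n * (finsler_pseudodist \<A> N n x y / (1 + finsler_pseudodist \<A> N n x y)))"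


section \<open>Functionals, critical points and the Palais-Smale condition\<close>

definition C1_functional ::
  "('m::topological_space, 'f::frechet_space) chart set \<Rightarrow> ('m \<Rightarrow> real) \<Rightarrow> bool" where
  "C1_functional \<A> \<phi> \<longleftrightarrow> (\<forall>c\<in>charts \<A>. keller_C1_on (snd c ` fst c) (\<phi> \<circ> chart_inv c))"

text \<open>\<open>\<phi>'(x,h)\<close>: the common value of the limits taken in the charts at \<open>x\<close>.\<close>

definition functional_deriv ::
  "('m::topological_space, 'f::frechet_space) chart set \<Rightarrow> ('m \<Rightarrow> real) \<Rightarrow> 'm \<Rightarrow> ('m, 'f) tvec \<Rightarrow> real"
  where
  "functional_deriv \<A> \<phi> x h = (THE r. \<forall>c\<in>charts_at \<A> x.
     ((\<lambda>t::real. (\<phi> (chart_inv c (snd c x + t *\<^sub>R chart_push c h)) - \<phi> x) / t) \<longlongrightarrow> r) (at 0))"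

definition critical_point ::
  "('m::topological_space, 'f::frechet_space) chart set \<Rightarrow> ('m \<Rightarrow> real) \<Rightarrow> 'm \<Rightarrow> bool" where
  "critical_point \<A> \<phi> x \<longleftrightarrow>
     (\<exists>c\<in>charts_at \<A> x. dir_deriv (\<phi> \<circ> chart_inv c) (snd c x) = (\<lambda>h. 0))"

definition Cr ::
  "('m::topological_space, 'f::frechet_space) chart set \<Rightarrow> ('m \<Rightarrow> real) \<Rightarrow> real \<Rightarrow> 'm set" where
  "Cr \<A> \<phi> c = {x. critical_point \<A> \<phi> x \<and> \<phi> x = c}"

definition critical_value ::
  "('m::topological_space, 'f::frechet_space) chart set \<Rightarrow> ('m \<Rightarrow> real) \<Rightarrow> real \<Rightarrow> bool" where
  "critical_value \<A> \<phi> c \<longleftrightarrow> Cr \<A> \<phi> c \<noteq> {}"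

definition B_infinity ::
  "('m::topological_space, 'f::frechet_space) chart set \<Rightarrow>
     (nat \<Rightarrow> 'm \<times> ('m, 'f) tvec \<Rightarrow> real) \<Rightarrow> 'm \<Rightarrow> ('m, 'f) tvec set" where
  "B_infinity \<A> N x = (\<Inter>n. {h \<in> tangent_space \<A> x. N n (x, h) \<le> 1})"

definition slope ::
  "('m::topological_space, 'f::frechet_space) chart set \<Rightarrow>
     (nat \<Rightarrow> 'm \<times> ('m, 'f) tvec \<Rightarrow> real) \<Rightarrow> ('m \<Rightarrow> real) \<Rightarrow> 'm \<Rightarrow> real" where
  "slope \<A> N \<phi> x = (INF h\<in>B_infinity \<A> N x. functional_deriv \<A> \<phi> x h)"

definition palais_smale ::
  "('m::topological_space, 'f::frechet_space) chart set \<Rightarrow>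
     (nat \<Rightarrow> 'm \<times> ('m, 'f) tvec \<Rightarrow> real) \<Rightarrow> ('m \<Rightarrow> real) \<Rightarrow> real \<Rightarrow> 'm set \<Rightarrow> bool" where
  "palais_smale \<A> N \<phi> c A \<longleftrightarrow>
     (\<forall>m::nat \<Rightarrow> 'm. range m \<subseteq> A \<and> (\<lambda>i. \<phi> (m i)) \<longlonglongrightarrow> c \<and> (\<lambda>i. slope \<A> N \<phi> (m i)) \<longlonglongrightarrow> 0 \<longrightarrow>
        (\<exists>r l. strict_mono r \<and> (m \<circ> r) \<longlonglongrightarrow> l))"

end

theory Submission
  imports Defs
begin

text \<open>
  The proof deforms the separating open set instead of the paths. Suppose that \<open>U\<close> contains \<open>x0\<close>,
  that its closure does not contain \<open>x1\<close>, that \<open>\<phi> \<ge> c\<close> on the frontier of \<open>U\<close>, and that the set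
  \<open>K\<close> of frontier points at level \<open>c\<close> contains no critical point. Around each \<open>z \<in> K\<close> there is a
  continuous map \<open>\<eta>\<close> of the manifold into itself which fixes \<open>x0\<close> and \<open>x1\<close>, strictly decreases \<open>\<phi>\<close>
  near \<open>z\<close>, and strictly decreases \<open>\<phi>\<close> at every point that it moves
  (\<open>descending_push\<close>). The preimage of \<open>U\<close> under \<open>\<eta>\<close> still separates \<open>x0\<close> from \<open>x1\<close>, still has
  \<open>\<phi> \<ge> c\<close> on its frontier, and has lost the points near \<open>z\<close> from its set \<open>K\<close> (\<open>finite_push\<close>).
  The set \<open>K\<close> is compact (\<open>compact_fibre_part\<close>), since \<open>\<phi>\<close> is closed and every point of \<open>K\<close> is a
  limit of points at other levels. After finitely many steps \<open>K\<close> is empty. The image of the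
  frontier is closed and no longer contains \<open>c\<close>, so \<open>\<phi> \<ge> c + \<delta>\<close> on the frontier with some
  \<open>\<delta> > 0\<close>. Every path from \<open>x0\<close> to \<open>x1\<close> crosses the frontier, which contradicts the definition of
  \<open>c\<close> (\<open>minimax_critical_point\<close>).

  The crossings also show that \<open>c\<close> is at least the infimum of \<open>\<phi>\<close> on the frontier of the given
  \<open>U\<close>. If the two are equal, the argument applies to this \<open>U\<close>. If \<open>c\<close> is larger, it applies
  to the path component of \<open>x0\<close> in \<open>{y. \<phi> y < c}\<close>: its frontier lies at level \<open>c\<close>,
  and \<open>x1\<close> is not in its closure, since otherwise a path would connect \<open>x0\<close> and \<open>x1\<close> below level
  \<open>c\<close>.

  Both the compactness of \<open>K\<close> and the local descents need the manifold to be a regular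
  topological space. That is a consequence of the Finsler structure (\<open>finsler_regular\<close>).
\<close>

section \<open>Continuous seminorms on Frechet spaces\<close>

lemma seminorm_ge0: "seminorm q \<Longrightarrow> 0 \<le> q x"
  and seminorm_scaleR: "seminorm q \<Longrightarrow> q (r *\<^sub>R x) = \<bar>r\<bar> * q x"
  and seminorm_add: "seminorm q \<Longrightarrow> q (x + y) \<le> q x + q y"
  by (auto simp: seminorm_def)

lemma seminorm_0: "seminorm q \<Longrightarrow> q 0 = 0"
  using seminorm_scaleR[of q 0 0] by simp

lemma seminorm_minus: "seminorm q \<Longrightarrow> q (- x) = q x"
  using seminorm_scaleR[of q "-1" x] by simp

lemma seminorm_diff: "seminorm q \<Longrightarrow> q (x - y) \<le> q x + q y"
  using seminorm_add[of q x "- y"] seminorm_minus[of q y] by simp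

lemma seminorm_minus_commute: "seminorm q \<Longrightarrow> q (x - y) = q (y - x)"
  using seminorm_minus[of q "x - y"] by simp

lemma seminorm_triangle: "seminorm q \<Longrightarrow> q (x - z) \<le> q (x - y) + q (y - z)"
  using seminorm_add[of q "x - y" "y - z"] by simp

text \<open>
  Continuity of a seminorm is encoded as openness of all its balls; this works in
  \<open>real_vector_t2\<close>, where the vector operations are not assumed to be continuous.
\<close>

definition continuous_seminorm :: "('a::real_vector_t2 \<Rightarrow> real) \<Rightarrow> bool" where
  "continuous_seminorm q \<longleftrightarrow> seminorm q \<and> (\<forall>x e. open {y. q (y - x) < e})"

lemma continuous_seminorm_imp: "continuous_seminorm q \<Longrightarrow> seminorm q"
  by (simp add: continuous_seminorm_def)

lemma continuous_seminorm_ball: "continuous_seminorm q \<Longrightarrow> open {y. q (y - x) < e}"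
  by (simp add: continuous_seminorm_def)

lemma continuous_seminorm_max:
  assumes "continuous_seminorm p" "continuous_seminorm q"
  shows "continuous_seminorm (\<lambda>x. max (p x) (q x))"
proof -
  have sp: "seminorm p" and sq: "seminorm q"
    using assms by (auto simp: continuous_seminorm_def)
  have "seminorm (\<lambda>x. max (p x) (q x))"
    unfolding seminorm_def
  proof (intro conjI allI)
    fix x y and r :: real
    show "0 \<le> max (p x) (q x)" using seminorm_ge0[OF sp, of x] by simp
    show "max (p (r *\<^sub>R x)) (q (r *\<^sub>R x)) = \<bar>r\<bar> * max (p x) (q x)"
      by (simp add: seminorm_scaleR[OF sp] seminorm_scaleR[OF sq] max_mult_distrib_left)
    show "max (p (x + y)) (q (x + y)) \<le> max (p x) (q x) + max (p y) (q y)"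
      using seminorm_add[OF sp, of x y] seminorm_add[OF sq, of x y] by (simp add: max_def)
  qed
  moreover have "open {y. max (p (y - x)) (q (y - x)) < e}" for x e
  proof -
    have "{y. max (p (y - x)) (q (y - x)) < e} = {y. p (y - x) < e} \<inter> {y. q (y - x) < e}"
      by auto
    then show ?thesis
      using assms by (simp add: open_Int continuous_seminorm_ball)
  qed
  ultimately show ?thesis by (simp add: continuous_seminorm_def)
qed

lemma continuous_seminorm_component:
  assumes "seminorms_give_topology p"
  shows "continuous_seminorm (p n)"
proof -
  have s: "seminorm (p n)" and o: "\<And>S. (\<forall>x\<in>S. \<exists>I e. finite I \<and> e > 0 \<and> {y. \<forall>n\<in>I. p n (y - x) < e} \<subseteq> S) \<Longrightarrow> open S"
    using assms by (auto simp: seminorms_give_topology_def)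
  have "open {y. p n (y - x) < e}" for x e
  proof (rule o, rule ballI)
    fix z assume z: "z \<in> {y. p n (y - x) < e}"
    have "{y. \<forall>i\<in>{n}. p i (y - z) < e - p n (z - x)} \<subseteq> {y. p n (y - x) < e}"
    proof
      fix y assume "y \<in> {y. \<forall>i\<in>{n}. p i (y - z) < e - p n (z - x)}"
      then show "y \<in> {y. p n (y - x) < e}" using seminorm_triangle[OF s, of y x z] by simp
    qed
    then show "\<exists>I e'. finite I \<and> e' > 0 \<and> {y. \<forall>n\<in>I. p n (y - z) < e'} \<subseteq> {y. p n (y - x) < e}"
      using z by (intro exI[of _ "{n}"] exI[of _ "e - p n (z - x)"]) auto
  qed
  with s show ?thesis by (simp add: continuous_seminorm_def)
qed

lemma seminorms_give_topology_ballE: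
  assumes "seminorms_give_topology p" "open S" "x \<in> S"
  obtains I and e :: real where "finite I" "e > 0" "{y. \<forall>n\<in>I. p n (y - x) < e} \<subseteq> S"
proof -
  have "\<forall>x\<in>S. \<exists>I e. finite I \<and> e > 0 \<and> {y. \<forall>n\<in>I. p n (y - x) < e} \<subseteq> S"
    using assms(1,2) by (simp add: seminorms_give_topology_def)
  with assms(3) that show ?thesis by blast
qed

lemma continuous_seminorm_finite_family:
  assumes "seminorms_give_topology p" and "finite I"
  shows "\<exists>q. continuous_seminorm q \<and> (\<forall>i\<in>I. \<forall>u. p i u \<le> q u)"
  using assms(2)
proof induction
  case empty
  show ?case
    by (intro exI[of _ "\<lambda>_. 0"]) (auto simp: continuous_seminorm_def seminorm_def)
next
  case (insert i I)
  then obtain q where "continuous_seminorm q" "\<forall>i\<in>I. \<forall>u. p i u \<le> q u" by blast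
  then show ?case
    using continuous_seminorm_max[OF continuous_seminorm_component[OF assms(1)]]
    by (intro exI[of _ "\<lambda>x. max (p i x) (q x)"]) (auto simp: le_max_iff_disj)
qed

lemma open_contains_seminorm_ball:
  fixes S :: "'a::frechet_space set"
  assumes "open S" "x \<in> S"
  obtains q e where "continuous_seminorm q" "e > 0" "{y. q (y - x) < e} \<subseteq> S"
proof -
  obtain p :: "nat \<Rightarrow> 'a \<Rightarrow> real" where p: "seminorms_give_topology p"
    using frechet_ex by blast
  obtain I e where I: "finite I" "e > 0" "{y. \<forall>n\<in>I. p n (y - x) < e} \<subseteq> S"
    by (rule seminorms_give_topology_ballE[OF p assms])
  obtain q where q: "continuous_seminorm q" "\<forall>i\<in>I. \<forall>u. p i u \<le> q u"
    using continuous_seminorm_finite_family[OF p I(1)] by blast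
  have "{y. q (y - x) < e} \<subseteq> {y. \<forall>n\<in>I. p n (y - x) < e}"
    using q(2) le_less_trans by blast
  then have "{y. q (y - x) < e} \<subseteq> S"
    using I(3) by (rule order_trans)
  then show ?thesis using that q(1) I(2) by blast
qed

lemma open_contains_graded_ball:
  fixes S :: "'a::real_vector_t2 set" and p :: "nat \<Rightarrow> 'a \<Rightarrow> real"
  assumes p: "seminorms_give_topology p" and mono: "\<And>n u. p n u \<le> p (Suc n) u"
    and "open S" "x \<in> S"
  obtains n e where "e > 0" "{y. p n (y - x) < e} \<subseteq> S"
proof -
  obtain I e where I: "finite I" "e > 0" "{y. \<forall>n\<in>I. p n (y - x) < e} \<subseteq> S"
    by (rule seminorms_give_topology_ballE[OF p assms(3,4)])
  have le: "p i u \<le> p (Max (insert 0 I)) u" if "i \<in> I" for i u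
    by (rule lift_Suc_mono_le[of "\<lambda>n. p n u", OF mono]) (use I(1) that in simp)
  have "{y. p (Max (insert 0 I)) (y - x) < e} \<subseteq> {y. \<forall>n\<in>I. p n (y - x) < e}"
    using le le_less_trans by blast
  then have "{y. p (Max (insert 0 I)) (y - x) < e} \<subseteq> S"
    using I(3) by (rule order_trans)
  then show ?thesis using that I(2) by blast
qed

lemma tendsto_seminormI:
  fixes l :: "'a::frechet_space"
  assumes "\<And>q e. continuous_seminorm q \<Longrightarrow> e > 0 \<Longrightarrow> eventually (\<lambda>x. q (f x - l) < e) F"
  shows "(f \<longlongrightarrow> l) F"
proof (rule topological_tendstoI)
  fix S assume "open S" "l \<in> S"
  then obtain q e where "continuous_seminorm q" "e > 0" "{y. q (y - l) < e} \<subseteq> S"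
    using open_contains_seminorm_ball by blast
  then show "eventually (\<lambda>x. f x \<in> S) F"
    using assms[of q e] by (auto elim: eventually_mono)
qed

lemma tendsto_seminormD:
  fixes l :: "'a::frechet_space"
  assumes "(f \<longlongrightarrow> l) F" "continuous_seminorm q"
  shows "((\<lambda>x. q (f x - l)) \<longlongrightarrow> 0) F"
proof (rule tendstoI)
  fix e :: real assume "e > 0"
  have "eventually (\<lambda>x. f x \<in> {y. q (y - l) < e}) F"
    using assms \<open>e > 0\<close> seminorm_0[OF continuous_seminorm_imp, of q]
    by (intro topological_tendstoD[OF assms(1)]) (auto simp: continuous_seminorm_ball)
  then show "eventually (\<lambda>x. dist (q (f x - l)) 0 < e) F"
    by eventually_elim (use seminorm_ge0[OF continuous_seminorm_imp[OF assms(2)]] in auto)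
qed

lemma tendsto_continuous_seminorm:
  fixes l :: "'a::frechet_space"
  assumes "(f \<longlongrightarrow> l) F" "continuous_seminorm q"
  shows "((\<lambda>x. q (f x)) \<longlongrightarrow> q l) F"
proof (rule LIM_zero_cancel, rule Lim_null_comparison[OF _ tendsto_seminormD[OF assms]])
  note s = continuous_seminorm_imp[OF assms(2)]
  have "\<bar>q (f x) - q l\<bar> \<le> q (f x - l)" for x
    using seminorm_triangle[OF s, of "f x" 0 l] seminorm_triangle[OF s, of l 0 "f x"]
      seminorm_minus_commute[OF s, of "f x" l] by simp
  then show "eventually (\<lambda>x. norm (q (f x) - q l) \<le> q (f x - l)) F"
    by simp
qed

lemma tendsto_seminorm_squeeze:
  fixes l :: "'a::frechet_space"
  assumes "\<And>q. continuous_seminorm q \<Longrightarrow> \<exists>b. (b \<longlongrightarrow> 0) F \<and> (\<forall>x. q (f x - l) \<le> b x)"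
  shows "(f \<longlongrightarrow> l) F"
proof (rule tendsto_seminormI)
  fix q :: "'a \<Rightarrow> real" and e :: real
  assume "continuous_seminorm q" "e > 0"
  then obtain b where b: "(b \<longlongrightarrow> 0) F" "\<And>x. q (f x - l) \<le> b x"
    using assms by blast
  show "eventually (\<lambda>x. q (f x - l) < e) F"
    using order_tendstoD(2)[OF b(1) \<open>e > 0\<close>] by eventually_elim (rule le_less_trans[OF b(2)])
qed

lemma frechet_tendsto_add:
  fixes f g :: "'b \<Rightarrow> 'a::frechet_space"
  assumes "(f \<longlongrightarrow> a) F" "(g \<longlongrightarrow> b) F"
  shows "((\<lambda>x. f x + g x) \<longlongrightarrow> a + b) F"
proof (rule tendsto_seminorm_squeeze, intro exI conjI allI)
  fix q :: "'a \<Rightarrow> real" and x assume q: "continuous_seminorm q"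
  then have s: "seminorm q" by (rule continuous_seminorm_imp)
  have "f x + g x - (a + b) = (f x - a) + (g x - b)" by simp
  then show "q (f x + g x - (a + b)) \<le> q (f x - a) + q (g x - b)"
    using seminorm_add[OF s, of "f x - a" "g x - b"] by (simp only:)
  show "((\<lambda>x. q (f x - a) + q (g x - b)) \<longlongrightarrow> 0) F"
    using tendsto_add[OF tendsto_seminormD[OF assms(1) q] tendsto_seminormD[OF assms(2) q]] by simp
qed

lemma frechet_tendsto_scaleR:
  fixes g :: "'b \<Rightarrow> 'a::frechet_space"
  assumes "(r \<longlongrightarrow> \<rho>) F" "(g \<longlongrightarrow> b) F"
  shows "((\<lambda>x. r x *\<^sub>R g x) \<longlongrightarrow> \<rho> *\<^sub>R b) F"
proof (rule tendsto_seminorm_squeeze, intro exI conjI allI)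
  fix q :: "'a \<Rightarrow> real" and x assume q: "continuous_seminorm q"
  then have s: "seminorm q" by (rule continuous_seminorm_imp)
  have "r x *\<^sub>R g x - \<rho> *\<^sub>R b = r x *\<^sub>R (g x - b) + (r x - \<rho>) *\<^sub>R b"
    by (simp add: algebra_simps)
  then show "q (r x *\<^sub>R g x - \<rho> *\<^sub>R b) \<le> \<bar>r x\<bar> * q (g x - b) + \<bar>r x - \<rho>\<bar> * q b"
    using seminorm_add[OF s, of "r x *\<^sub>R (g x - b)" "(r x - \<rho>) *\<^sub>R b"]
    by (simp add: seminorm_scaleR[OF s])
  have "((\<lambda>x. \<bar>r x\<bar> * q (g x - b) + \<bar>r x - \<rho>\<bar> * q b) \<longlongrightarrow> \<bar>\<rho>\<bar> * 0 + \<bar>\<rho> - \<rho>\<bar> * q b) F"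
    by (intro tendsto_intros assms tendsto_seminormD[OF assms(2) q])
  then show "((\<lambda>x. \<bar>r x\<bar> * q (g x - b) + \<bar>r x - \<rho>\<bar> * q b) \<longlongrightarrow> 0) F" by simp
qed

lemma frechet_tendsto_diff:
  fixes f g :: "'b \<Rightarrow> 'a::frechet_space"
  assumes "(f \<longlongrightarrow> a) F" "(g \<longlongrightarrow> b) F"
  shows "((\<lambda>x. f x - g x) \<longlongrightarrow> a - b) F"
  using frechet_tendsto_add[OF assms(1) frechet_tendsto_scaleR[OF tendsto_const[of "-1"] assms(2)]]
  by simp

text \<open>
  Completeness does not depend on the family of seminorms that gives the topology, so the
  Finsler seminorms at a point can replace the family provided by the class.
\<close>

lemma frechet_convergentI:
  fixes X :: "nat \<Rightarrow> 'a::frechet_space"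
  assumes p: "seminorms_give_topology p"
    and C: "\<And>n e. e > 0 \<Longrightarrow> \<exists>k. \<forall>i\<ge>k. \<forall>j\<ge>k. p n (X i - X j) < e"
  obtains l where "X \<longlonglongrightarrow> l"
proof -
  obtain p' :: "nat \<Rightarrow> 'a \<Rightarrow> real" where p': "seminorms_give_topology p'"
    and cp: "\<And>X. (\<forall>n. \<forall>e>0. \<exists>k. \<forall>i\<ge>k. \<forall>j\<ge>k. p' n (X i - X j) < e) \<Longrightarrow> (\<exists>l. X \<longlonglongrightarrow> l)"
    using frechet_ex by blast
  have "\<exists>l. X \<longlonglongrightarrow> l"
  proof (rule cp, intro allI impI)
    fix n and e :: real assume "e > 0"
    have q: "continuous_seminorm (p' n)" by (rule continuous_seminorm_component[OF p'])
    have *: "open {y. p' n (y - 0) < e}" "0 \<in> {y. p' n (y - 0) < e}"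
      using continuous_seminorm_ball[OF q, of 0 e] seminorm_0[OF continuous_seminorm_imp[OF q]] \<open>e > 0\<close> by auto
    obtain I d where I: "finite I" "d > 0" "{y. \<forall>n\<in>I. p n (y - 0) < d} \<subseteq> {y. p' n (y - 0) < e}"
      by (rule seminorms_give_topology_ballE[OF p *])
    obtain k where k: "\<And>m i j. i \<ge> k m \<Longrightarrow> j \<ge> k m \<Longrightarrow> p m (X i - X j) < d"
      using C[OF I(2)] by metis
    have "p' n (X i - X j) < e" if "i \<ge> Max (insert 0 (k ` I))" "j \<ge> Max (insert 0 (k ` I))" for i j
    proof -
      have "p m (X i - X j) < d" if "m \<in> I" for m
        using \<open>m \<in> I\<close> \<open>i \<ge> _\<close> \<open>j \<ge> _\<close> I(1) by (intro k) auto
      then show ?thesis using I(3) by auto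
    qed
    then show "\<exists>k. \<forall>i\<ge>k. \<forall>j\<ge>k. p' n (X i - X j) < e" by blast
  qed
  then show ?thesis using that by blast
qed

lemma continuous_on_segment:
  fixes x v :: "'a::frechet_space"
  shows "continuous_on T (\<lambda>t::real. x + t *\<^sub>R v)"
  unfolding continuous_on_def
  by (intro ballI frechet_tendsto_add frechet_tendsto_scaleR tendsto_const tendsto_ident_at)

text \<open>
  The mean value inequality for a single seminorm, proved by subdivision instead of the
  Hahn--Banach theorem.
\<close>

lemma seminorm_mean_value:
  fixes g :: "real \<Rightarrow> 'a::frechet_space"
  assumes q: "continuous_seminorm q" and ab: "a \<le> b"
    and der: "\<And>s. s \<in> {a..b} \<Longrightarrow> ((\<lambda>t. (g (s + t) - g s) /\<^sub>R t) \<longlongrightarrow> g' s) (at 0)"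
    and bd: "\<And>s. s \<in> {a..b} \<Longrightarrow> q (g' s - v) \<le> C"
  shows "q (g b - g a - (b - a) *\<^sub>R v) \<le> C * (b - a)"
proof -
  have s: "seminorm q" by (rule continuous_seminorm_imp[OF q])
  have *: "q (g b - g a - (b - a) *\<^sub>R v) \<le> (C + e) * (b - a)" if "e > 0" for e
    using ab
  proof (induction rule: Bolzano)
    case (trans a b c)
    have "g c - g a - (c - a) *\<^sub>R v = (g b - g a - (b - a) *\<^sub>R v) + (g c - g b - (c - b) *\<^sub>R v)"
      by (simp add: algebra_simps)
    then show ?case using trans seminorm_add[OF s, of "g b - g a - (b - a) *\<^sub>R v" "g c - g b - (c - b) *\<^sub>R v"]
      by (simp add: algebra_simps)
  next
    case (local x)
    then have "x \<in> {a..b}" by simp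
    have "eventually (\<lambda>t. q ((g (x + t) - g x) /\<^sub>R t - g' x) < e) (at 0)"
      using order_tendstoD(2)[OF tendsto_seminormD[OF der[OF \<open>x \<in> {a..b}\<close>] q]] \<open>e > 0\<close> by auto
    then obtain d where d: "d > 0" "\<And>t. t \<noteq> 0 \<Longrightarrow> \<bar>t\<bar> < d \<Longrightarrow> q ((g (x + t) - g x) /\<^sub>R t - g' x) < e"
      by (auto simp: eventually_at dist_real_def)
    have est: "q (g y - g x - (y - x) *\<^sub>R v) \<le> (C + e) * \<bar>y - x\<bar>" if "\<bar>y - x\<bar> < d" for y
    proof (cases "y = x")
      case True then show ?thesis by (simp add: seminorm_0[OF s])
    next
      case False
      let ?w = "(g y - g x) /\<^sub>R (y - x)"
      have "q (?w - v) \<le> q (?w - g' x) + q (g' x - v)" by (rule seminorm_triangle[OF s])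
      also have "\<dots> \<le> C + e" using d(2)[of "y - x"] that False bd[OF \<open>x \<in> {a..b}\<close>] by simp
      finally have "\<bar>y - x\<bar> * q (?w - v) \<le> \<bar>y - x\<bar> * (C + e)" by (intro mult_left_mono) auto
      also have "\<bar>y - x\<bar> * q (?w - v) = q (g y - g x - (y - x) *\<^sub>R v)"
        unfolding seminorm_scaleR[OF s, symmetric] using False by (simp add: scaleR_diff_right)
      finally show ?thesis by (simp add: mult.commute)
    qed
    show ?case
    proof (intro exI[of _ d] conjI allI impI d(1))
      fix u w assume uw: "u \<le> x \<and> x \<le> w \<and> w - u < d"
      have "g w - g u - (w - u) *\<^sub>R v = (g w - g x - (w - x) *\<^sub>R v) - (g u - g x - (u - x) *\<^sub>R v)"
        by (simp add: algebra_simps)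
      then have "q (g w - g u - (w - u) *\<^sub>R v) \<le> q (g w - g x - (w - x) *\<^sub>R v) + q (g u - g x - (u - x) *\<^sub>R v)"
        by (simp only: seminorm_diff[OF s])
      also have "\<dots> \<le> (C + e) * \<bar>w - x\<bar> + (C + e) * \<bar>u - x\<bar>"
        using uw by (intro add_mono est) auto
      also have "\<dots> = (C + e) * (w - u)" using uw by (simp add: algebra_simps)
      finally show "q (g w - g u - (w - u) *\<^sub>R v) \<le> (C + e) * (w - u)" .
    qed
  qed
  show ?thesis
  proof (rule field_le_epsilon)
    fix e :: real assume "e > 0"
    have "q (g b - g a - (b - a) *\<^sub>R v) \<le> (C + e / (b - a + 1)) * (b - a)"
      using ab \<open>e > 0\<close> by (intro *) auto
    also have "\<dots> \<le> C * (b - a) + e"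
      using ab \<open>e > 0\<close> by (simp add: field_simps)
    finally show "q (g b - g a - (b - a) *\<^sub>R v) \<le> C * (b - a) + e" .
  qed
qed

section \<open>Derivatives of Keller maps\<close>

lemma has_dir_deriv_unique: "has_dir_deriv f x h d \<Longrightarrow> has_dir_deriv f x h d' \<Longrightarrow> d = d'"
  unfolding has_dir_deriv_def by (rule tendsto_unique[OF trivial_limit_at])

lemma dir_deriv_eq: "has_dir_deriv f x h d \<Longrightarrow> dir_deriv f x h = d"
  unfolding dir_deriv_def by (rule the_equality) (auto intro: has_dir_deriv_unique)

lemma keller_C1_on_has_dir_deriv:
  "keller_C1_on U f \<Longrightarrow> x \<in> U \<Longrightarrow> has_dir_deriv f x h (dir_deriv f x h)"
  unfolding keller_C1_on_def using dir_deriv_eq by metis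

lemma keller_C1_on_linear:
  assumes "keller_C1_on U f" "x \<in> U"
  shows "linear (dir_deriv f x)" "continuous_on UNIV (dir_deriv f x)"
proof -
  have "continuous_map (top_of_set U) compact_open_topology (dir_deriv f)"
    using assms by (simp add: keller_C1_on_def)
  then have "dir_deriv f x \<in> topspace compact_open_topology"
    using assms(2) by (auto simp: continuous_map_def)
  then have "dir_deriv f x \<in> continuous_linear_maps"
    by (auto simp: compact_open_topology_def)
  then show "linear (dir_deriv f x)" "continuous_on UNIV (dir_deriv f x)"
    by (auto simp: continuous_linear_maps_def)
qed

text \<open>
  A convergent sequence together with its limit is the compact set on which the compact-open
  topology is tested below.
\<close>

lemma compact_range_with_limit:
  fixes X :: "nat \<Rightarrow> 'a::topological_space"
  assumes X: "X \<longlonglongrightarrow> l"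
  shows "compact (insert l (range X))"
proof (rule compactI)
  fix C assume C: "\<forall>t\<in>C. open t" "insert l (range X) \<subseteq> \<Union>C"
  then obtain S where S: "S \<in> C" "l \<in> S" by blast
  then obtain N where N: "\<And>n. n \<ge> N \<Longrightarrow> X n \<in> S"
    using topological_tendstoD[OF X, of S] C(1) by (auto simp: eventually_sequentially)
  have "\<forall>n. \<exists>t. t \<in> C \<and> X n \<in> t"
    using C(2) by auto
  then obtain f where f: "\<And>n. f n \<in> C \<and> X n \<in> f n"
    by metis
  have "insert l (range X) \<subseteq> \<Union>(insert S (f ` {..<N}))"
  proof (intro insert_subsetI image_subsetI)
    show "X n \<in> \<Union>(insert S (f ` {..<N}))" for n
      using N[of n] f[of n] by (cases "n < N") auto
  qed (use S in simp)
  then show "\<exists>C'\<subseteq>C. finite C' \<and> insert l (range X) \<subseteq> \<Union>C'"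
    using S(1) f by (intro exI[of _ "insert S (f ` {..<N})"] conjI) blast+
qed

lemma keller_C1_on_open_dir_deriv:
  assumes K: "keller_C1_on U f" and C: "compact C" and W: "open W"
  shows "open {y \<in> U. dir_deriv f y ` C \<subseteq> W}"
proof -
  have oU: "open U" and cm: "continuous_map (top_of_set U) compact_open_topology (dir_deriv f)"
    using K by (auto simp: keller_C1_on_def)
  define S where "S = {L \<in> continuous_linear_maps. L ` C \<subseteq> W}"
  have "openin compact_open_topology S"
    unfolding compact_open_topology_def S_def
    by (rule topology_generated_by_Basis) (use C W in blast)
  then have "openin (top_of_set U) {y \<in> topspace (top_of_set U). dir_deriv f y \<in> S}"
    by (rule openin_continuous_map_preimage[OF cm])
  then have "open {y \<in> U. dir_deriv f y \<in> S}"
    using openin_open_trans[OF _ oU] by simp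
  moreover have "{y \<in> U. dir_deriv f y \<in> S} = {y \<in> U. dir_deriv f y ` C \<subseteq> W}"
    using keller_C1_on_linear[OF K] by (auto simp: S_def continuous_linear_maps_def)
  ultimately show ?thesis by simp
qed

lemma keller_C1_on_tendsto_dir_deriv:
  assumes K: "keller_C1_on U f" and x: "x \<in> U" and X: "X \<longlonglongrightarrow> x" and H: "H \<longlonglongrightarrow> h"
  shows "(\<lambda>n. dir_deriv f (X n) (H n)) \<longlonglongrightarrow> dir_deriv f x h"
proof (rule topological_tendstoI)
  fix W assume W: "open W" "dir_deriv f x h \<in> W"
  note lin = keller_C1_on_linear[OF K x]
  have oV: "open (dir_deriv f x -` W)"
    using lin(2) W(1) by (rule open_vimage[rotated])
  have "eventually (\<lambda>n. H n \<in> dir_deriv f x -` W) sequentially"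
    using topological_tendstoD[OF H oV] W(2) by simp
  then obtain N where N: "\<And>n. n \<ge> N \<Longrightarrow> H n \<in> dir_deriv f x -` W"
    by (auto simp: eventually_sequentially)
  define C where "C = insert h (range (\<lambda>n. H (n + N)))"
  have "compact C"
    unfolding C_def using LIMSEQ_ignore_initial_segment[OF H] by (rule compact_range_with_limit)
  have o: "open {y \<in> U. dir_deriv f y ` C \<subseteq> W}"
    by (rule keller_C1_on_open_dir_deriv[OF K \<open>compact C\<close> W(1)])
  have "dir_deriv f x ` C \<subseteq> W"
    using W N by (auto simp: C_def)
  then have "eventually (\<lambda>n. X n \<in> {y \<in> U. dir_deriv f y ` C \<subseteq> W}) sequentially"
    using x by (intro topological_tendstoD[OF X o]) simp
  moreover have "eventually (\<lambda>n. H n \<in> C) sequentially"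
    unfolding eventually_sequentially
  proof (intro exI allI impI)
    fix n assume "N \<le> n"
    then have "H n = H ((n - N) + N)" by simp
    then show "H n \<in> C" unfolding C_def by blast
  qed
  ultimately show "eventually (\<lambda>n. dir_deriv f (X n) (H n) \<in> W) sequentially"
    by eventually_elim auto
qed

text \<open>
  Hadamard differentiability, expressed by sequences: the directions \<open>H n\<close> may vary along the
  sequence. Unlike directional differentiability it is stable under composition, which yields
  the chain rule for transition maps. The definition does not ask \<open>L\<close> to be linear.
\<close>

definition has_hadamard_deriv ::
  "('e::frechet_space \<Rightarrow> 'f::frechet_space) \<Rightarrow> 'e \<Rightarrow> ('e \<Rightarrow> 'f) \<Rightarrow> bool" where
  "has_hadamard_deriv f x L \<longleftrightarrow>
     (\<forall>(T::nat \<Rightarrow> real) H h. T \<longlonglongrightarrow> 0 \<longrightarrow> (\<forall>n. T n \<noteq> 0) \<longrightarrow> H \<longlonglongrightarrow> h \<longrightarrow>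
        (\<lambda>n. (f (x + T n *\<^sub>R H n) - f x) /\<^sub>R T n) \<longlonglongrightarrow> L h)"

lemma has_hadamard_derivD:
  assumes "has_hadamard_deriv f x L" "T \<longlonglongrightarrow> 0" "\<And>n. T n \<noteq> 0" "H \<longlonglongrightarrow> h"
  shows "(\<lambda>n. (f (x + T n *\<^sub>R H n) - f x) /\<^sub>R T n) \<longlonglongrightarrow> L h"
  using assms unfolding has_hadamard_deriv_def by blast

lemma has_hadamard_deriv_imp_dir_deriv:
  assumes "has_hadamard_deriv f x L"
  shows "dir_deriv f x = L"
proof
  fix h
  have "has_dir_deriv f x h (L h)"
    unfolding has_dir_deriv_def tendsto_at_iff_sequentially comp_def
    using has_hadamard_derivD[OF assms _ _ tendsto_const] by simp
  then show "dir_deriv f x h = L h" by (rule dir_deriv_eq)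
qed

lemma keller_C1_on_has_hadamard_deriv:
  fixes f :: "'a::frechet_space \<Rightarrow> 'b::frechet_space"
  assumes K: "keller_C1_on U f" and x: "x \<in> U"
  shows "has_hadamard_deriv f x (dir_deriv f x)"
  unfolding has_hadamard_deriv_def
proof (intro allI impI)
  fix T :: "nat \<Rightarrow> real" and H :: "nat \<Rightarrow> 'a" and h assume T: "T \<longlonglongrightarrow> 0" "\<forall>n. T n \<noteq> 0" and H: "H \<longlonglongrightarrow> h"
  have oU: "open U" using K by (simp add: keller_C1_on_def)
  show "(\<lambda>n. (f (x + T n *\<^sub>R H n) - f x) /\<^sub>R T n) \<longlonglongrightarrow> dir_deriv f x h"
  proof (rule tendsto_seminormI)
    fix q :: "'b \<Rightarrow> real" and e :: real assume q: "continuous_seminorm q" and e: "e > 0"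
    have s: "seminorm q" by (rule continuous_seminorm_imp[OF q])
    define good where "good n s \<longleftrightarrow> x + (s * T n) *\<^sub>R H n \<in> U \<and>
      q (dir_deriv f (x + (s * T n) *\<^sub>R H n) (H n) - dir_deriv f x h) < e / 2" for n s
    \<comment> \<open>\<open>\<sigma> n\<close> is a parameter at which the estimate fails, if there is one; along this single
      sequence of parameters continuity of the derivative applies, which makes the estimate
      uniform on the segment.\<close>
    define \<sigma> where "\<sigma> n = (if \<exists>s\<in>{0..1}. \<not> good n s then SOME s. s \<in> {0..1} \<and> \<not> good n s else 0)" for n
    have \<sigma>: "\<sigma> n \<in> {0..1}" "good n (\<sigma> n) \<Longrightarrow> \<forall>s\<in>{0..1}. good n s" for n
    proof -
      have "\<sigma> n \<in> {0..1} \<and> (good n (\<sigma> n) \<longrightarrow> (\<forall>s\<in>{0..1}. good n s))"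
      proof (cases "\<exists>s\<in>{0..1}. \<not> good n s")
        case True
        then have "\<exists>s. s \<in> {0..1} \<and> \<not> good n s" by blast
        from someI_ex[OF this] show ?thesis using True by (simp add: \<sigma>_def)
      qed (auto simp: \<sigma>_def)
      then show "\<sigma> n \<in> {0..1}" "good n (\<sigma> n) \<Longrightarrow> \<forall>s\<in>{0..1}. good n s" by auto
    qed
    have "(\<lambda>n. \<sigma> n * T n) \<longlonglongrightarrow> 0"
    proof (rule Lim_null_comparison)
      show "eventually (\<lambda>n. norm (\<sigma> n * T n) \<le> \<bar>T n\<bar>) sequentially"
        using \<sigma>(1) by (intro always_eventually) (auto simp: abs_mult intro: mult_left_le_one_le)
      show "(\<lambda>n. \<bar>T n\<bar>) \<longlonglongrightarrow> 0" using T(1) by (rule tendsto_rabs_zero)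
    qed
    from frechet_tendsto_add[OF tendsto_const[of x] frechet_tendsto_scaleR[OF this H]]
    have X: "(\<lambda>n. x + (\<sigma> n * T n) *\<^sub>R H n) \<longlonglongrightarrow> x" by simp
    have ev: "eventually (\<lambda>n. good n (\<sigma> n)) sequentially"
      unfolding good_def
      using topological_tendstoD[OF X oU x]
        order_tendstoD(2)[OF tendsto_seminormD[OF keller_C1_on_tendsto_dir_deriv[OF K x X H] q], of "e / 2"] e
      by (intro eventually_conj) auto
    then show "eventually (\<lambda>n. q ((f (x + T n *\<^sub>R H n) - f x) /\<^sub>R T n - dir_deriv f x h) < e) sequentially"
    proof eventually_elim
      case (elim n)
      then have g: "good n s" if "s \<in> {0..1}" for s using \<sigma>(2) that by blast
      let ?g = "\<lambda>s. f (x + s *\<^sub>R (T n *\<^sub>R H n))"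
      have "q (?g 1 - ?g 0 - (1 - 0) *\<^sub>R (T n *\<^sub>R dir_deriv f x h)) \<le> (\<bar>T n\<bar> * (e / 2)) * (1 - 0)"
      proof (rule seminorm_mean_value[OF q])
        fix s :: real assume "s \<in> {0..1}"
        note gs = g[OF this, unfolded good_def]
        let ?y = "x + s *\<^sub>R (T n *\<^sub>R H n)"
        have y: "?y \<in> U" and b: "q (dir_deriv f ?y (H n) - dir_deriv f x h) < e / 2"
          using gs by auto
        show "((\<lambda>t. (?g (s + t) - ?g s) /\<^sub>R t) \<longlongrightarrow> dir_deriv f ?y (T n *\<^sub>R H n)) (at 0)"
          using keller_C1_on_has_dir_deriv[OF K y, of "T n *\<^sub>R H n"]
          by (simp add: has_dir_deriv_def scaleR_add_left add.assoc distrib_right)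
        have "dir_deriv f ?y (T n *\<^sub>R H n) - T n *\<^sub>R dir_deriv f x h
            = T n *\<^sub>R (dir_deriv f ?y (H n) - dir_deriv f x h)"
          by (simp only: linear_scale[OF keller_C1_on_linear(1)[OF K y]] scaleR_diff_right)
        then show "q (dir_deriv f ?y (T n *\<^sub>R H n) - T n *\<^sub>R dir_deriv f x h) \<le> \<bar>T n\<bar> * (e / 2)"
          using mult_left_mono[OF less_imp_le[OF b] abs_ge_zero[of "T n"]]
          by (simp only: seminorm_scaleR[OF s])
      qed simp
      then have le: "q (f (x + T n *\<^sub>R H n) - f x - T n *\<^sub>R dir_deriv f x h) \<le> \<bar>T n\<bar> * (e / 2)" by simp
      have "T n \<noteq> 0" using T(2) by simp
      then have "f (x + T n *\<^sub>R H n) - f x - T n *\<^sub>R dir_deriv f x h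
          = T n *\<^sub>R ((f (x + T n *\<^sub>R H n) - f x) /\<^sub>R T n - dir_deriv f x h)"
        by (simp add: scaleR_diff_right)
      with le have "\<bar>T n\<bar> * q ((f (x + T n *\<^sub>R H n) - f x) /\<^sub>R T n - dir_deriv f x h) \<le> \<bar>T n\<bar> * (e / 2)"
        by (simp only: seminorm_scaleR[OF s])
      then have "q ((f (x + T n *\<^sub>R H n) - f x) /\<^sub>R T n - dir_deriv f x h) \<le> e / 2"
        using \<open>T n \<noteq> 0\<close> by simp
      then show ?case using e by simp
    qed
  qed
qed

lemma has_hadamard_deriv_compose:
  fixes f :: "'a::frechet_space \<Rightarrow> 'b::frechet_space"
  assumes f: "has_hadamard_deriv f x L" and g: "has_hadamard_deriv g (f x) L'"
    and S: "open S" "x \<in> S" and eq: "\<And>y. y \<in> S \<Longrightarrow> k y = g (f y)"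
  shows "has_hadamard_deriv k x (\<lambda>h. L' (L h))"
  unfolding has_hadamard_deriv_def
proof (intro allI impI)
  fix T :: "nat \<Rightarrow> real" and H :: "nat \<Rightarrow> 'a" and h assume T: "T \<longlonglongrightarrow> 0" "\<forall>n. T n \<noteq> 0" and H: "H \<longlonglongrightarrow> h"
  define H' where "H' n = (f (x + T n *\<^sub>R H n) - f x) /\<^sub>R T n" for n
  have H': "H' \<longlonglongrightarrow> L h"
    unfolding H'_def by (rule has_hadamard_derivD[OF f]) (use T H in auto)
  have "(\<lambda>n. (g (f x + T n *\<^sub>R H' n) - g (f x)) /\<^sub>R T n) \<longlonglongrightarrow> L' (L h)"
    by (rule has_hadamard_derivD[OF g]) (use T H' in auto)
  moreover have "f x + T n *\<^sub>R H' n = f (x + T n *\<^sub>R H n)" for n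
    using T(2) by (simp add: H'_def)
  ultimately have lim: "(\<lambda>n. (g (f (x + T n *\<^sub>R H n)) - g (f x)) /\<^sub>R T n) \<longlonglongrightarrow> L' (L h)" by simp
  have "(\<lambda>n. x + T n *\<^sub>R H n) \<longlonglongrightarrow> x"
    using frechet_tendsto_add[OF tendsto_const[of x] frechet_tendsto_scaleR[OF T(1) H]] by simp
  from topological_tendstoD[OF this S]
  have "eventually (\<lambda>n. (g (f (x + T n *\<^sub>R H n)) - g (f x)) /\<^sub>R T n = (k (x + T n *\<^sub>R H n) - k x) /\<^sub>R T n) sequentially"
    by eventually_elim (use eq S in simp)
  then show "(\<lambda>n. (k (x + T n *\<^sub>R H n) - k x) /\<^sub>R T n) \<longlonglongrightarrow> L' (L h)"
    by (rule Lim_transform_eventually[OF lim])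
qed

section \<open>Charts and tangent vectors\<close>

lemma chart_homeomorphism:
  "is_chart c \<Longrightarrow> homeomorphism (fst c) (snd c ` fst c) (snd c) (chart_inv c)"
  by (simp add: is_chart_def)

lemma chart_inv_left [simp]: "is_chart c \<Longrightarrow> y \<in> fst c \<Longrightarrow> chart_inv c (snd c y) = y"
  by (rule homeomorphism_apply1[OF chart_homeomorphism])

lemma chart_inj: "is_chart c \<Longrightarrow> y \<in> fst c \<Longrightarrow> z \<in> fst c \<Longrightarrow> snd c y = snd c z \<Longrightarrow> y = z"
  by (metis chart_inv_left)

lemma chart_inv_right:
  assumes "is_chart c" "u \<in> snd c ` fst c"
  shows "chart_inv c u \<in> fst c" "snd c (chart_inv c u) = u"
  using assms by auto

lemma chart_continuous:
  assumes "is_chart c"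
  shows "continuous_on (fst c) (snd c)" "continuous_on (snd c ` fst c) (chart_inv c)"
  using homeomorphism_cont1[OF chart_homeomorphism[OF assms]]
    homeomorphism_cont2[OF chart_homeomorphism[OF assms]] by auto

lemma chart_open: "is_chart c \<Longrightarrow> open (fst c)" "is_chart c \<Longrightarrow> open (snd c ` fst c)"
  by (auto simp: is_chart_def)

lemma chart_open_image:
  assumes c: "is_chart c" and S: "open S" "S \<subseteq> fst c"
  shows "open (snd c ` S)"
proof -
  have "snd c ` S = snd c ` fst c \<inter> chart_inv c -` S"
    using S(2) chart_inv_left[OF c] chart_inv_right[OF c] by (force simp: image_iff)
  then show ?thesis
    using continuous_open_preimage[OF chart_continuous(2)[OF c] chart_open(2)[OF c] S(1)] by simp
qed

lemma chart_open_vimage: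
  assumes c: "is_chart c" and S: "open S"
  shows "open (fst c \<inter> snd c -` S)"
  by (rule continuous_open_preimage[OF chart_continuous(1)[OF c] chart_open(1)[OF c] S])

lemma charts_atD: "c \<in> charts_at \<A> x \<Longrightarrow> is_chart c" "c \<in> charts_at \<A> x \<Longrightarrow> x \<in> fst c"
   "c \<in> charts_at \<A> x \<Longrightarrow> c \<in> charts \<A>"
  by (auto simp: charts_at_def charts_def)

lemma C1_atlas_cover:
  assumes "C1_atlas \<A>" obtains c where "c \<in> \<A>" "x \<in> fst c"
proof -
  have "(\<Union>c\<in>\<A>. fst c) = UNIV"
    using assms unfolding C1_atlas_def by blast
  then show ?thesis using that by blast
qed

lemma transition_hadamard_atlas:
  assumes "C1_transition c d" "is_chart c" "x \<in> fst c \<inter> fst d"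
  shows "has_hadamard_deriv (transition c d) (snd c x) (dir_deriv (transition c d) (snd c x))"
  using assms by (intro keller_C1_on_has_hadamard_deriv) (auto simp: C1_transition_def)

lemma transition_compose:
  assumes c: "is_chart c" and d: "is_chart d" and x: "x \<in> fst c" "x \<in> fst d"
    and L: "has_hadamard_deriv (transition c d) (snd c x) L"
    and L': "has_hadamard_deriv (transition d e) (snd d x) L'"
  shows "has_hadamard_deriv (transition c e) (snd c x) (\<lambda>h. L' (L h))"
proof (rule has_hadamard_deriv_compose[OF L])
  show "has_hadamard_deriv (transition d e) (transition c d (snd c x)) L'"
    using L' c x by (simp add: transition_def)
  show "open (snd c ` (fst c \<inter> fst d))"
    by (intro chart_open_image[OF c] open_Int chart_open(1) c d) auto
  show "snd c x \<in> snd c ` (fst c \<inter> fst d)" using x by auto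
  show "transition c e y = transition d e (transition c d y)" if "y \<in> snd c ` (fst c \<inter> fst d)" for y
    using that c d by (auto simp: transition_def)
qed

text \<open>
  Charts of the maximal atlas are compatible with the charts of \<open>\<A>\<close> by definition; between
  each other, one passes through a chart of \<open>\<A>\<close>.
\<close>

lemma transition_hadamard:
  assumes A: "C1_atlas \<A>" and c: "c \<in> charts_at \<A> x" and d: "d \<in> charts_at \<A> x"
  shows "has_hadamard_deriv (transition c d) (snd c x) (dir_deriv (transition c d) (snd c x))"
proof -
  obtain a where a: "a \<in> \<A>" "x \<in> fst a" "is_chart a"
    using C1_atlas_cover[OF A] A unfolding C1_atlas_def by metis
  note cd = charts_atD[OF c] charts_atD[OF d]
  have ca: "C1_transition c a" and ad: "C1_transition a d"
    using c d a(1) by (auto simp: charts_at_def charts_def)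
  have "has_hadamard_deriv (transition c d) (snd c x)
      (\<lambda>h. dir_deriv (transition a d) (snd a x) (dir_deriv (transition c a) (snd c x) h))"
    by (rule transition_compose[OF cd(1) a(3) cd(2) a(2) transition_hadamard_atlas[OF ca cd(1)]
        transition_hadamard_atlas[OF ad a(3)]]) (use cd a in simp_all)
  then show ?thesis
    by (simp add: has_hadamard_deriv_imp_dir_deriv)
qed

lemma transition_chain:
  assumes A: "C1_atlas \<A>" and c: "c \<in> charts_at \<A> x" and d: "d \<in> charts_at \<A> x" and e: "e \<in> charts_at \<A> x"
  shows "dir_deriv (transition c e) (snd c x) h
    = dir_deriv (transition d e) (snd d x) (dir_deriv (transition c d) (snd c x) h)"
proof -
  have "has_hadamard_deriv (transition c e) (snd c x)
      (\<lambda>h. dir_deriv (transition d e) (snd d x) (dir_deriv (transition c d) (snd c x) h))"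
    by (rule transition_compose[OF charts_atD(1)[OF c] charts_atD(1)[OF d] charts_atD(2)[OF c]
        charts_atD(2)[OF d] transition_hadamard[OF A c d] transition_hadamard[OF A d e]])
  then show ?thesis by (simp add: has_hadamard_deriv_imp_dir_deriv)
qed

text \<open>
  Coordinate vectors that correspond under the derivative of the transition map represent the
  same tangent vector.
\<close>

lemma bundle_chart_transition:
  assumes A: "C1_atlas \<A>" and c: "c \<in> charts_at \<A> x" and d: "d \<in> charts_at \<A> x"
  shows "bundle_chart \<A> d (x, dir_deriv (transition c d) (snd c x) u) = bundle_chart \<A> c (x, u)"
proof -
  have *: "tangent_rel \<A> x `` {(c, u)} = {(e, dir_deriv (transition c e) (snd c x) u) | e. e \<in> charts_at \<A> x}"
    if "c \<in> charts_at \<A> x" for c u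
    using that unfolding tangent_rel_def Image_def by blast
  show ?thesis
    unfolding bundle_chart_def prod.case *[OF c] *[OF d]
    by (auto simp: transition_chain[OF A c d, symmetric])
qed

lemma bundle_chart_in_tangent_bundle:
  "c \<in> charts_at \<A> x \<Longrightarrow> bundle_chart \<A> c (x, u) \<in> tangent_bundle \<A>"
  by (auto simp: bundle_chart_def tangent_bundle_def tangent_space_def intro: quotientI)

lemma atlas_subset_charts: "C1_atlas \<A> \<Longrightarrow> \<A> \<subseteq> charts \<A>"
  by (auto simp: C1_atlas_def charts_def)

lemma exists_chart_at: assumes "C1_atlas \<A>" obtains c where "c \<in> charts_at \<A> x"
proof -
  obtain c where "c \<in> \<A>" "x \<in> fst c"
    by (rule C1_atlas_cover[OF assms])
  then have "c \<in> charts_at \<A> x"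
    using atlas_subset_charts[OF assms] by (auto simp: charts_at_def)
  then show ?thesis by (rule that)
qed

section \<open>Regularity of Finsler manifolds\<close>

text \<open>
  The local comparison of the seminorms is only needed with the constant \<open>2\<close>; what matters is
  that one neighbourhood serves all seminorms at once.
\<close>

lemma finsler_chart:
  assumes F: "finsler_structure \<A> N"
  obtains c W where "c \<in> charts_at \<A> x" "open W" "x \<in> W" "W \<subseteq> fst c"
    "seminorms_give_topology (\<lambda>n u. N n (bundle_chart \<A> c (x, u)))"
    "\<And>n u. N n (bundle_chart \<A> c (x, u)) \<le> N (Suc n) (bundle_chart \<A> c (x, u))"
    "\<And>w n u. w \<in> W \<Longrightarrow> N n (bundle_chart \<A> c (x, u)) \<le> 2 * N n (bundle_chart \<A> c (w, u))"
    "\<And>w n u. w \<in> W \<Longrightarrow> N n (bundle_chart \<A> c (w, u)) \<le> 2 * N n (bundle_chart \<A> c (x, u))"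
proof -
  have "\<exists>c\<in>charts_at \<A> x. finsler_trivial (top_of_set (fst c)) (\<lambda>n. N n \<circ> bundle_chart \<A> c)"
    using F unfolding finsler_structure_def by blast
  then obtain c where c: "c \<in> charts_at \<A> x"
    and t: "finsler_trivial (top_of_set (fst c)) (\<lambda>n. N n \<circ> bundle_chart \<A> c)" by blast
  have x: "x \<in> topspace (top_of_set (fst c))" using charts_atD(2)[OF c] by simp
  have sgt: "seminorms_give_topology (\<lambda>n u. N n (bundle_chart \<A> c (x, u)))"
    using t x unfolding finsler_trivial_def comp_def by blast
  have "\<forall>k>1. \<exists>W. openin (top_of_set (fst c)) W \<and> x \<in> W \<and>
        (\<forall>w\<in>W. \<forall>n u. 1 / k * (N n \<circ> bundle_chart \<A> c) (x, u) \<le> (N n \<circ> bundle_chart \<A> c) (w, u) \<and>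
           (N n \<circ> bundle_chart \<A> c) (w, u) \<le> k * (N n \<circ> bundle_chart \<A> c) (x, u))"
    using t x unfolding finsler_trivial_def by blast
  from this[rule_format, of 2] obtain W where W: "openin (top_of_set (fst c)) W" "x \<in> W"
    "\<And>w n u. w \<in> W \<Longrightarrow> 1 / 2 * N n (bundle_chart \<A> c (x, u)) \<le> N n (bundle_chart \<A> c (w, u)) \<and>
       N n (bundle_chart \<A> c (w, u)) \<le> 2 * N n (bundle_chart \<A> c (x, u))"
    unfolding comp_def by auto
  have "open W" using openin_open_trans[OF W(1) chart_open(1)[OF charts_atD(1)[OF c]]] .
  moreover have "W \<subseteq> fst c" using openin_imp_subset[OF W(1)] .
  moreover have "N n (bundle_chart \<A> c (x, u)) \<le> N (Suc n) (bundle_chart \<A> c (x, u))" for n u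
    using F bundle_chart_in_tangent_bundle[OF c] unfolding finsler_structure_def by blast
  moreover have "N n (bundle_chart \<A> c (x, u)) \<le> 2 * N n (bundle_chart \<A> c (w, u))" if "w \<in> W" for w n u
    using W(3)[OF that, of n u] by simp
  moreover have "N n (bundle_chart \<A> c (w, u)) \<le> 2 * N n (bundle_chart \<A> c (x, u))" if "w \<in> W" for w n u
    using W(3)[OF that, of n u] by simp
  ultimately show ?thesis using that[OF c _ W(2) _ sgt] by blast
qed

text \<open>
  A Hausdorff Frechet manifold need not be regular, but a Finsler structure makes it so. Let \<open>B s\<close>
  be the ball of radius \<open>s\<close> around \<open>x\<close> for the \<open>n\<close>-th seminorm in a chart \<open>c\<close>, and let \<open>p\<close> be a
  limit point of \<open>B r\<close>. Join \<open>p\<close> to a nearby point of \<open>B r\<close> by a straight segment in a chart at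
  \<open>p\<close>. As long as the segment stays in \<open>B (3 * r)\<close>, it is a Lipschitz curve in \<open>c\<close> for every
  seminorm, with a small constant for the \<open>n\<close>-th one. By completeness of the model space it has
  a limit in \<open>c\<close> at the parameter where it would leave this ball, at distance at most \<open>2 * r\<close>;
  by the Hausdorff property this limit is the point of the segment. So the segment never leaves
  \<open>B (3 * r)\<close>, and \<open>p \<in> B (3 * r)\<close>.
\<close>

lemma finsler_regular:
  fixes \<A> :: "('m::t2_space, 'f::frechet_space) chart set" and x :: 'm
  assumes A: "C1_atlas \<A>" and F: "finsler_structure \<A> N" and V: "open V" "x \<in> V"
  obtains B where "open B" "x \<in> B" "closure B \<subseteq> V"
proof -
  obtain c W where c: "c \<in> charts_at \<A> x" and W: "open W" "x \<in> W" "W \<subseteq> fst c"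
    and sgt: "seminorms_give_topology (\<lambda>n u. N n (bundle_chart \<A> c (x, u)))"
    and gr: "\<And>n u. N n (bundle_chart \<A> c (x, u)) \<le> N (Suc n) (bundle_chart \<A> c (x, u))"
    and cmp: "\<And>w n u. w \<in> W \<Longrightarrow> N n (bundle_chart \<A> c (x, u)) \<le> 2 * N n (bundle_chart \<A> c (w, u))"
    by (rule finsler_chart[OF F, of x]) (assumption | rule that)+
  define q where "q n u = N n (bundle_chart \<A> c (x, u))" for n u
  note ic = charts_atD(1)[OF c] and xc = charts_atD(2)[OF c]
  have sq: "seminorms_give_topology q" using sgt by (simp add: q_def[abs_def])
  have cq: "continuous_seminorm (q n)" for n by (rule continuous_seminorm_component[OF sq])
  note nq = continuous_seminorm_imp[OF cq]
  have oVW: "open (snd c ` (V \<inter> W))"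
    using V W by (intro chart_open_image[OF ic]) auto
  have xVW: "snd c x \<in> snd c ` (V \<inter> W)" using V W by blast
  obtain n e where e: "e > 0" and ball: "{u. q n (u - snd c x) < e} \<subseteq> snd c ` (V \<inter> W)"
    by (rule open_contains_graded_ball[OF sq _ oVW xVW]) (auto simp: q_def gr)
  define r where "r = e / 3"
  have r: "r > 0" "3 * r = e" using e by (auto simp: r_def)
  define B where "B s = {y \<in> V \<inter> W. q n (snd c y - snd c x) < s}" for s
  have oB: "open (B s)" for s
  proof -
    have eqB: "B s = (V \<inter> W) \<inter> (fst c \<inter> snd c -` {u. q n (u - snd c x) < s})"
      using W(3) by (auto simp: B_def)
    show ?thesis
      unfolding eqB by (intro open_Int chart_open_vimage[OF ic] continuous_seminorm_ball[OF cq] V(1) W(1))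
  qed
  have Bc: "B s \<subseteq> fst c" for s using W(3) by (auto simp: B_def)
  have xB: "x \<in> B r" using V(2) W(2) r seminorm_0[OF nq] by (simp add: B_def)
  have lift: "chart_inv c u \<in> B (3 * r)" "snd c (chart_inv c u) = u" if u: "q n (u - snd c x) < 3 * r" for u
  proof -
    have "u \<in> snd c ` (V \<inter> W)" using ball u r by auto
    then obtain y where "y \<in> V \<inter> W" "u = snd c y" by blast
    then show "chart_inv c u \<in> B (3 * r)" "snd c (chart_inv c u) = u"
      using u W(3) chart_inv_left[OF ic, of y] by (auto simp: B_def)
  qed
  have "closure (B r) \<subseteq> B (3 * r)"
  proof
    fix p assume p: "p \<in> closure (B r)"
    obtain d Wp where d: "d \<in> charts_at \<A> p" and Wp: "open Wp" "p \<in> Wp" "Wp \<subseteq> fst d"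
      and sgt': "seminorms_give_topology (\<lambda>n u. N n (bundle_chart \<A> d (p, u)))"
      and gr': "\<And>n u. N n (bundle_chart \<A> d (p, u)) \<le> N (Suc n) (bundle_chart \<A> d (p, u))"
      and cmp': "\<And>w n u. w \<in> Wp \<Longrightarrow> N n (bundle_chart \<A> d (w, u)) \<le> 2 * N n (bundle_chart \<A> d (p, u))"
      by (rule finsler_chart[OF F, of p]) (assumption | rule that)+
    define q' where "q' n u = N n (bundle_chart \<A> d (p, u))" for n u
    note id = charts_atD(1)[OF d]
    have sq': "seminorms_give_topology q'" using sgt' by (simp add: q'_def[abs_def])
    have cq': "continuous_seminorm (q' n)" for n by (rule continuous_seminorm_component[OF sq'])
    note nq' = continuous_seminorm_imp[OF cq']
    have oWp: "open (snd d ` Wp)" by (rule chart_open_image[OF id Wp(1,3)])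
    have pWp: "snd d p \<in> snd d ` Wp" using Wp by blast
    obtain m \<delta>0 where \<delta>0: "\<delta>0 > 0" and ball'0: "{u. q' m (u - snd d p) < \<delta>0} \<subseteq> snd d ` Wp"
      by (rule open_contains_graded_ball[OF sq' _ oWp pWp]) (auto simp: q'_def gr')
    define D where "D = {y \<in> Wp. q' m (snd d y - snd d p) < \<delta>0 \<and> q' n (snd d y - snd d p) < r / 4}"
    have eqD: "D = Wp \<inter> (fst d \<inter> snd d -` {u. q' m (u - snd d p) < \<delta>0}) \<inter>
        (fst d \<inter> snd d -` {u. q' n (u - snd d p) < r / 4})"
      using Wp(3) by (auto simp: D_def)
    have "open D"
      unfolding eqD by (intro open_Int chart_open_vimage[OF id] continuous_seminorm_ball[OF cq'] Wp(1))
    moreover have "p \<in> D" using Wp(2) \<delta>0 r seminorm_0[OF nq'] by (simp add: D_def)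
    ultimately obtain y where y: "y \<in> D" "y \<in> B r"
      using p by (auto simp: closure_iff_nhds_not_empty)
    define v where "v = snd d y - snd d p"
    define g where "g s = chart_inv d (snd d p + s *\<^sub>R v)" for s
    have qv: "q' n v < r / 4" "q' m v < \<delta>0" using y by (auto simp: v_def D_def)
    have seg: "snd d p + s *\<^sub>R v \<in> snd d ` Wp" if "s \<in> {0..1}" for s
    proof -
      have "q' m ((snd d p + s *\<^sub>R v) - snd d p) = s * q' m v"
        using that by (simp add: seminorm_scaleR[OF nq'])
      also have "\<dots> \<le> q' m v"
        using that seminorm_ge0[OF nq'] by (simp add: mult_left_le_one_le)
      finally show ?thesis using ball'0 qv by auto
    qed
    have gW: "g s \<in> Wp" "snd d (g s) = snd d p + s *\<^sub>R v" if s: "s \<in> {0..1}" for s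
    proof -
      obtain z where z: "z \<in> Wp" "snd d p + s *\<^sub>R v = snd d z" using seg[OF s] by blast
      then have "g s = z" using Wp(3) chart_inv_left[OF id, of z] by (auto simp: g_def)
      then show "g s \<in> Wp" "snd d (g s) = snd d p + s *\<^sub>R v" using z by auto
    qed
    have gc: "continuous_on {0..1} g"
      unfolding g_def
      by (rule continuous_on_compose2[OF chart_continuous(2)[OF id] continuous_on_segment])
         (use seg Wp(3) in blast)
    have g0: "g 0 = p" using chart_inv_left[OF id] charts_atD(2)[OF d] by (simp add: g_def)
    have g1: "g 1 = y" using chart_inv_left[OF id, of y] y Wp(3) by (auto simp: g_def v_def D_def)
    \<comment> \<open>the segment read in the chart \<open>c\<close>; meaningful only while \<open>g s\<close> lies in its domain\<close>
    define \<gamma> where "\<gamma> s = snd c (g s)" for s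
    have lip: "q j (\<gamma> b - \<gamma> a) \<le> 4 * q' j v * (b - a)"
      if ab: "0 \<le> a" "a \<le> b" "b \<le> 1" and inB: "\<And>s. s \<in> {a..b} \<Longrightarrow> g s \<in> B (3 * r)" for a b j
    proof -
      have "q j (\<gamma> b - \<gamma> a - (b - a) *\<^sub>R 0) \<le> (4 * q' j v) * (b - a)"
      proof (rule seminorm_mean_value[OF cq ab(2)])
        fix s assume s: "s \<in> {a..b}"
        then have s01: "s \<in> {0..1}" using ab by auto
        have gs: "g s \<in> W" "g s \<in> fst c" "g s \<in> Wp" "g s \<in> fst d"
          using inB[OF s] Bc gW(1)[OF s01] Wp(3) by (auto simp: B_def)
        have ca: "c \<in> charts_at \<A> (g s)" and da: "d \<in> charts_at \<A> (g s)"
          using c d gs by (auto simp: charts_at_def)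
        let ?D = "dir_deriv (transition d c) (snd d (g s)) v"
        have hd: "has_dir_deriv (transition d c) (snd d (g s)) v ?D"
          using transition_hadamard[OF A da ca] has_hadamard_derivD[OF _ _ _ tendsto_const]
          unfolding has_dir_deriv_def tendsto_at_iff_sequentially comp_def by fastforce
        have "transition d c (snd d (g s) + t *\<^sub>R v) = \<gamma> (s + t)" for t
          using gW(2)[OF s01] by (simp add: transition_def \<gamma>_def g_def scaleR_add_left add.assoc)
        from this this[of 0]
        show "((\<lambda>t. (\<gamma> (s + t) - \<gamma> s) /\<^sub>R t) \<longlongrightarrow> ?D) (at 0)"
          using hd by (simp add: has_dir_deriv_def)
        have "q j ?D \<le> 2 * N j (bundle_chart \<A> c (g s, ?D))"
          unfolding q_def by (rule cmp[OF gs(1)])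
        also have "bundle_chart \<A> c (g s, ?D) = bundle_chart \<A> d (g s, v)"
          by (rule bundle_chart_transition[OF A da ca])
        also have "2 * N j (bundle_chart \<A> d (g s, v)) \<le> 2 * (2 * q' j v)"
          unfolding q'_def using cmp'[OF gs(3)] by simp
        finally show "q j (?D - 0) \<le> 4 * q' j v" by simp
      qed
      then show ?thesis by simp
    qed
    \<comment> \<open>the segment is followed backwards from \<open>y = g 1\<close> to \<open>p = g 0\<close>\<close>
    define T where "T = {s \<in> {0..1}. \<forall>s'\<in>{s..1}. g s' \<in> B (3 * r)}"
    have "1 \<in> T" using g1 y r by (auto simp: T_def B_def)
    define \<tau> where "\<tau> = Inf T"
    have bT: "bdd_below T" by (auto simp: T_def intro!: bdd_belowI[of _ 0])
    have \<tau>: "0 \<le> \<tau>" "\<tau> \<le> 1"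
    proof -
      have "T \<noteq> {}" using \<open>1 \<in> T\<close> by blast
      then show "0 \<le> \<tau>" unfolding \<tau>_def by (rule cInf_greatest) (simp add: T_def)
      show "\<tau> \<le> 1" unfolding \<tau>_def by (rule cInf_lower[OF \<open>1 \<in> T\<close> bT])
    qed
    have above: "s \<in> T" if "\<tau> < s" "s \<le> 1" for s
    proof -
      obtain s0 where "s0 \<in> T" "s0 < s"
        using \<open>\<tau> < s\<close> \<open>1 \<in> T\<close> bT unfolding \<tau>_def by (subst (asm) cInf_less_iff) auto
      then show ?thesis using that by (auto simp: T_def)
    qed
    have near: "q n (\<gamma> s - snd c x) \<le> 2 * r" if "s \<in> T" for s
    proof -
      have "q n (\<gamma> 1 - \<gamma> s) \<le> 4 * q' n v * (1 - s)"
        using that by (intro lip) (auto simp: T_def)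
      also have "\<dots> \<le> r * 1"
        using qv that r seminorm_ge0[OF nq', of n v] by (intro mult_mono) (auto simp: T_def)
      finally have "q n (\<gamma> s - \<gamma> 1) \<le> r" by (simp add: seminorm_minus_commute[OF nq])
      moreover have "q n (\<gamma> 1 - snd c x) \<le> r" using y g1 by (simp add: B_def \<gamma>_def)
      ultimately show ?thesis using seminorm_triangle[OF nq, of n "\<gamma> s" "snd c x" "\<gamma> 1"] by simp
    qed
    have "\<tau> \<in> T"
    proof (cases "\<tau> = 1")
      case False
      then have t1: "\<tau> < 1" using \<tau> by simp
      define S where "S k = \<tau> + (1 - \<tau>) * inverse (real (Suc k))" for k
      have S1: "\<tau> < S k" "S k \<le> 1" for k
      proof -
        have "inverse (real (Suc k)) \<le> 1" by (simp add: inverse_le_1_iff)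
        then have "(1 - \<tau>) * inverse (real (Suc k)) \<le> (1 - \<tau>) * 1"
          using t1 by (intro mult_left_mono) auto
        then show "S k \<le> 1" by (simp add: S_def)
        show "\<tau> < S k" using t1 by (simp add: S_def)
      qed
      then have ST: "S k \<in> T" for k by (intro above)
      have "(\<lambda>k. \<tau> + (1 - \<tau>) * inverse (real (Suc k))) \<longlonglongrightarrow> \<tau> + (1 - \<tau>) * 0"
        by (intro tendsto_intros LIMSEQ_inverse_real_of_nat)
      then have Sl: "S \<longlonglongrightarrow> \<tau>" by (simp add: S_def[abs_def])
      then have CS: "Cauchy S" by (rule LIMSEQ_imp_Cauchy)
      have lipS: "q j (\<gamma> (S i) - \<gamma> (S k)) \<le> 4 * q' j v * \<bar>S i - S k\<bar>" for i j k
      proof (cases "S k \<le> S i")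
        case True
        then show ?thesis
          using lip[of "S k" "S i" j] ST[of k] ST[of i] by (auto simp: T_def)
      next
        case False
        then show ?thesis
          using lip[of "S i" "S k" j] ST[of k] ST[of i] seminorm_minus_commute[OF nq, of j "\<gamma> (S i)" "\<gamma> (S k)"]
          by (auto simp: T_def)
      qed
      obtain l where l: "(\<lambda>k. \<gamma> (S k)) \<longlonglongrightarrow> l"
      proof (rule frechet_convergentI[OF sq])
        fix j and \<epsilon> :: real assume \<epsilon>: "\<epsilon> > 0"
        have pos: "4 * q' j v + 1 > 0" using seminorm_ge0[OF nq', of j v] by simp
        then obtain M where M: "\<And>i k. i \<ge> M \<Longrightarrow> k \<ge> M \<Longrightarrow> \<bar>S i - S k\<bar> < \<epsilon> / (4 * q' j v + 1)"
          using CS \<epsilon> unfolding Cauchy_def dist_real_def by (metis divide_pos_pos)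
        have "q j (\<gamma> (S i) - \<gamma> (S k)) < \<epsilon>" if "i \<ge> M" "k \<ge> M" for i k
        proof -
          have "q j (\<gamma> (S i) - \<gamma> (S k)) \<le> 4 * q' j v * \<bar>S i - S k\<bar>" by (rule lipS)
          also have "\<dots> \<le> (4 * q' j v + 1) * \<bar>S i - S k\<bar>" by (intro mult_right_mono) auto
          also have "\<dots> < (4 * q' j v + 1) * (\<epsilon> / (4 * q' j v + 1))"
            by (rule mult_strict_left_mono[OF M[OF that] pos])
          also have "\<dots> = \<epsilon>" using pos by simp
          finally show ?thesis .
        qed
        then show "\<exists>M. \<forall>i\<ge>M. \<forall>k\<ge>M. q j (\<gamma> (S i) - \<gamma> (S k)) < \<epsilon>" by blast
      qed
      have lx: "q n (l - snd c x) < 3 * r"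
      proof -
        have "eventually (\<lambda>k. q n (\<gamma> (S k) - l) < r) sequentially"
          using order_tendstoD(2)[OF tendsto_seminormD[OF l cq]] r by simp
        then obtain k where "q n (\<gamma> (S k) - l) < r"
          by (auto simp: eventually_sequentially)
        then show ?thesis
          using near[OF ST[of k]] seminorm_triangle[OF nq, of n l "snd c x" "\<gamma> (S k)"]
            seminorm_minus_commute[OF nq, of n l "\<gamma> (S k)"] by simp
      qed
      have lim1: "(\<lambda>k. g (S k)) \<longlonglongrightarrow> g \<tau>"
        using gc \<tau> S1 Sl unfolding continuous_on_sequentially comp_def
        by (auto simp: less_imp_le order_trans[OF \<tau>(1) less_imp_le[OF S1(1)]])
      have l_in: "l \<in> snd c ` fst c"
        using lift[OF lx] Bc by (metis image_eqI subsetD)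
      have "isCont (chart_inv c) l"
        using chart_continuous(2)[OF ic] l_in
        unfolding continuous_on_eq_continuous_at[OF chart_open(2)[OF ic]] by blast
      then have "(\<lambda>k. chart_inv c (\<gamma> (S k))) \<longlonglongrightarrow> chart_inv c l"
        by (rule isCont_tendsto_compose[OF _ l])
      moreover have "chart_inv c (\<gamma> (S k)) = g (S k)" for k
      proof -
        have "g (S k) \<in> B (3 * r)" using ST[of k] by (auto simp: T_def)
        then have "g (S k) \<in> fst c" using Bc by blast
        then show ?thesis unfolding \<gamma>_def by (rule chart_inv_left[OF ic])
      qed
      ultimately have "g \<tau> = chart_inv c l"
        using LIMSEQ_unique[OF lim1] by simp
      then have "g \<tau> \<in> B (3 * r)" using lift(1)[OF lx] by simp
      moreover have "g s \<in> B (3 * r)" if "\<tau> < s" "s \<le> 1" for s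
        using above[OF that] that by (auto simp: T_def)
      ultimately show ?thesis
        using \<tau> by (auto simp: T_def le_less)
    qed (use \<open>1 \<in> T\<close> in simp)
    have "\<tau> = 0"
    proof (rule ccontr)
      assume "\<tau> \<noteq> 0"
      then have tp: "\<tau> > 0" using \<tau> by simp
      have "g \<tau> \<in> B (3 * r)" using \<open>\<tau> \<in> T\<close> by (auto simp: T_def)
      moreover have "(g \<longlongrightarrow> g \<tau>) (at \<tau> within {0..1})"
        using gc \<tau> by (auto simp: continuous_on_def)
      ultimately have "eventually (\<lambda>s. g s \<in> B (3 * r)) (at \<tau> within {0..1})"
        using oB topological_tendstoD by blast
      then obtain \<eta> where \<eta>: "\<eta> > 0" "\<And>s. s \<in> {0..1} \<Longrightarrow> s \<noteq> \<tau> \<Longrightarrow> \<bar>s - \<tau>\<bar> < \<eta> \<Longrightarrow> g s \<in> B (3 * r)"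
        by (auto simp: eventually_at dist_real_def)
      define s0 where "s0 = max 0 (\<tau> - \<eta> / 2)"
      have s0: "0 \<le> s0" "s0 < \<tau>" "\<tau> - s0 < \<eta>" using tp \<eta>(1) by (auto simp: s0_def)
      have "s0 \<in> T"
        unfolding T_def
      proof (intro CollectI conjI ballI)
        show "s0 \<in> {0..1}" using s0 \<tau> by auto
        fix s assume s: "s \<in> {s0..1}"
        show "g s \<in> B (3 * r)"
        proof (cases "s < \<tau>")
          case True then show ?thesis using s s0 by (intro \<eta>(2)) auto
        next
          case False then show ?thesis using s \<open>\<tau> \<in> T\<close> by (auto simp: T_def)
        qed
      qed
      then have "\<tau> \<le> s0" unfolding \<tau>_def by (rule cInf_lower[OF _ bT])
      then show False using s0 by simp
    qed
    then have "g 0 \<in> B (3 * r)" using \<open>\<tau> \<in> T\<close> by (auto simp: T_def)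
    then show "p \<in> B (3 * r)" using g0 by simp
  qed
  moreover have "B (3 * r) \<subseteq> V" by (auto simp: B_def)
  ultimately show ?thesis using that[OF oB xB] by blast
qed

section \<open>Fibres of closed functions\<close>

text \<open>
  Vainstein's lemma: a closed map to the reals has compact fibre boundaries. A sequence \<open>z\<close> in
  \<open>K\<close> without accumulation points would have nearby points \<open>y n\<close> off the fibre, again without
  accumulation points, such that \<open>\<phi> (y n)\<close> tends to \<open>c\<close>; then the closed set of all \<open>y n\<close> would
  have an image that is not closed.
\<close>

lemma compact_fibre_part:
  fixes \<phi> :: "'m::{t2_space, second_countable_topology} \<Rightarrow> real"
  assumes reg: "\<And>V x::'m. open V \<Longrightarrow> x \<in> V \<Longrightarrow> \<exists>B. open B \<and> x \<in> B \<and> closure B \<subseteq> V"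
    and cont: "continuous_on UNIV \<phi>" and cl: "closed_map euclidean euclidean \<phi>"
    and K: "closed K" and Kc: "\<And>z. z \<in> K \<Longrightarrow> \<phi> z = c"
    and lim: "\<And>z. z \<in> K \<Longrightarrow> z \<in> closure {y. \<phi> y \<noteq> c}"
  shows "compact K"
  unfolding seq_compact_eq_compact[symmetric] seq_compact_eq_acc_point
proof (intro allI impI)
  fix T assume T: "infinite T \<and> countable T \<and> T \<subseteq> K"
  show "\<exists>x\<in>K. \<forall>U. x \<in> U \<and> open U \<longrightarrow> infinite (U \<inter> T)"
  proof (rule ccontr)
    assume neg: "\<not> (\<exists>x\<in>K. \<forall>U. x \<in> U \<and> open U \<longrightarrow> infinite (U \<inter> T))"
    obtain z :: "nat \<Rightarrow> 'm" where z: "inj z" "range z \<subseteq> T"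
      using T infinite_countable_subset by metis
    have fin: "\<exists>V. open V \<and> p \<in> V \<and> finite {n. z n \<in> V}" for p
    proof -
      have "\<exists>V. open V \<and> p \<in> V \<and> finite (V \<inter> T)"
      proof (cases "p \<in> K")
        case True
        then show ?thesis using neg by blast
      next
        case False
        moreover have "(- K) \<inter> T = {}" using T by blast
        ultimately show ?thesis using K by (intro exI[of _ "- K"]) (auto simp: open_Compl)
      qed
      then obtain V where V: "open V" "p \<in> V" "finite (V \<inter> T)" by blast
      have "z ` {n. z n \<in> V} \<subseteq> V \<inter> T" using z(2) by blast
      then have "finite (z ` {n. z n \<in> V})" using V(3) by (rule finite_subset)
      then have "finite {n. z n \<in> V}"
        by (rule finite_imageD) (rule inj_on_subset[OF z(1) subset_UNIV])
      then show ?thesis using V by blast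
    qed
    obtain BB :: "'m set set" where BB: "countable BB" "topological_basis BB"
      using ex_countable_basis by blast
    have "BB \<noteq> {}" using topological_basisE[OF BB(2) open_UNIV UNIV_I] by blast
    define b where "b = from_nat_into BB"
    have rb: "range b = BB" unfolding b_def using BB(1) \<open>BB \<noteq> {}\<close> by simp
    \<comment> \<open>\<open>y n\<close> avoids the closure of each of \<open>b 0, \<dots>, b n\<close> whose closure misses \<open>z n\<close>;
      with regularity this replaces a distance that tends to \<open>0\<close>\<close>
    define G where "G n = (\<Inter>k\<in>{k. k \<le> n \<and> z n \<notin> closure (b k)}. - closure (b k)) \<inter>
        \<phi> -` {c - inverse (real (Suc n))<..<c + inverse (real (Suc n))}" for n
    have "\<exists>y. y \<in> G n \<and> \<phi> y \<noteq> c" for n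
    proof -
      have "open (G n)"
        unfolding G_def
        by (intro open_Int open_INT ballI open_Compl closed_closure open_vimage open_greaterThanLessThan cont)
          simp
      moreover have zK: "z n \<in> K" using z(2) T by blast
      moreover have "z n \<in> G n" using Kc[OF zK] by (auto simp: G_def)
      ultimately show ?thesis
        using lim[OF zK] unfolding closure_iff_nhds_not_empty by blast
    qed
    then obtain y where y: "\<And>n. y n \<in> G n" "\<And>n. \<phi> (y n) \<noteq> c" by metis
    have finy: "\<exists>V. open V \<and> p \<in> V \<and> finite {n. y n \<in> V}" for p
    proof -
      obtain V0 where V0: "open V0" "p \<in> V0" "finite {n. z n \<in> V0}" using fin by blast
      obtain B where B: "open B" "p \<in> B" "closure B \<subseteq> V0" using reg[OF V0(1,2)] by blast
      obtain b' where b': "b' \<in> BB" "p \<in> b'" "b' \<subseteq> B" by (rule topological_basisE[OF BB(2) B(1,2)])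
      then obtain k where k: "b k = b'" using rb by blast
      have sub: "closure (b k) \<subseteq> V0" using k b'(3) B(3) closure_mono by blast
      have "{n. y n \<in> b k} \<subseteq> {n. z n \<in> V0} \<union> {..<k}"
      proof
        fix n assume n: "n \<in> {n. y n \<in> b k}"
        show "n \<in> {n. z n \<in> V0} \<union> {..<k}"
        proof (rule ccontr)
          assume "n \<notin> {n. z n \<in> V0} \<union> {..<k}"
          then have "k \<le> n" "z n \<notin> closure (b k)" using sub by auto
          then have "y n \<notin> closure (b k)" using y(1)[of n] unfolding G_def by blast
          then show False using n closure_subset by blast
        qed
      qed
      then have "finite {n. y n \<in> b k}" by (rule finite_subset) (simp add: V0(3))
      moreover have "open (b k)" using k b'(1) BB(2) topological_basis_open by blast
      ultimately show ?thesis using k b'(2) by blast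
    qed
    have "closed (range y)"
      unfolding closed_def
    proof (subst open_subopen, intro ballI)
      fix p assume p: "p \<in> - range y"
      obtain V where V: "open V" "p \<in> V" "finite {n. y n \<in> V}" using finy by blast
      have "open (V - y ` {n. y n \<in> V})"
        using V(1,3) by (intro open_Diff finite_imp_closed finite_imageI)
      then show "\<exists>T. open T \<and> p \<in> T \<and> T \<subseteq> - range y"
        using V(2) p by (intro exI[of _ "V - y ` {n. y n \<in> V}"]) auto
    qed
    then have cl2: "closed (\<phi> ` range y)" using cl by (simp add: closed_map_def)
    have "(\<lambda>n. \<phi> (y n)) \<longlonglongrightarrow> c"
    proof (rule LIM_zero_cancel, rule Lim_null_comparison[OF _ LIMSEQ_inverse_real_of_nat])
      show "eventually (\<lambda>n. norm (\<phi> (y n) - c) \<le> inverse (real (Suc n))) sequentially"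
      proof (rule always_eventually, rule allI)
        fix n
        have "\<phi> (y n) \<in> {c - inverse (real (Suc n))<..<c + inverse (real (Suc n))}"
          using y(1)[of n] unfolding G_def by blast
        then show "norm (\<phi> (y n) - c) \<le> inverse (real (Suc n))" unfolding real_norm_def by auto
      qed
    qed
    then have "c \<in> \<phi> ` range y"
      by (rule closed_sequentially[OF cl2, rotated]) simp
    then show False using y(2) by auto
  qed
qed

section \<open>Local descent at a regular point\<close>

lemma C1_functional_continuous:
  fixes \<A> :: "('m::t2_space, 'f::frechet_space) chart set"
  assumes A: "C1_atlas \<A>" and \<phi>: "C1_functional \<A> \<phi>"
  shows "continuous_on UNIV \<phi>"
proof -
  have "isCont \<phi> x" for x
  proof -
    obtain c where c: "c \<in> charts_at \<A> x" by (rule exists_chart_at[OF A])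
    note ic = charts_atD(1)[OF c]
    have "continuous_on (snd c ` fst c) (\<phi> \<circ> chart_inv c)"
      using \<phi> charts_atD(3)[OF c] by (auto simp: C1_functional_def keller_C1_on_def)
    then have "continuous_on (fst c) (\<lambda>y. (\<phi> \<circ> chart_inv c) (snd c y))"
      by (rule continuous_on_compose2[OF _ chart_continuous(1)[OF ic]]) auto
    moreover have "(\<phi> \<circ> chart_inv c) (snd c y) = \<phi> y" if "y \<in> fst c" for y
      using that by (simp add: chart_inv_left[OF ic])
    ultimately have "continuous_on (fst c) \<phi>"
      by (simp cong: continuous_on_cong)
    then show ?thesis
      using charts_atD(2)[OF c] continuous_on_eq_continuous_at[OF chart_open(1)[OF ic]] by blast
  qed
  then show ?thesis by (simp add: continuous_at_imp_continuous_on)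
qed

text \<open>
  A local descent. Near a point \<open>z\<close> that is not critical, choose in a chart a direction \<open>h\<close> in
  which \<open>\<phi>\<close> decreases and move \<open>y\<close> by \<open>\<omega> y\<close> times \<open>h\<close>, where \<open>\<omega>\<close> is a continuous cutoff
  function. Regularity is what allows the extension by the identity: the support of the cutoff
  function must be closed in the manifold, not only in the chart.
\<close>

lemma descending_push:
  fixes \<A> :: "('m::t2_space, 'f::frechet_space) chart set"
  assumes A: "C1_atlas \<A>"
    and reg: "\<And>V x::'m. open V \<Longrightarrow> x \<in> V \<Longrightarrow> \<exists>B. open B \<and> x \<in> B \<and> closure B \<subseteq> V"
    and \<phi>: "C1_functional \<A> \<phi>" and z: "\<not> critical_point \<A> \<phi> z" and V: "open V" "z \<in> V"
  obtains \<eta> S where "continuous_on UNIV \<eta>" "open S" "z \<in> S"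
    "\<And>y. \<eta> y = y \<or> \<phi> (\<eta> y) < \<phi> y" "\<And>y. y \<in> S \<Longrightarrow> \<phi> (\<eta> y) < \<phi> y"
    "\<And>y. y \<notin> V \<Longrightarrow> \<eta> y = y" "\<And>y. y \<in> V \<Longrightarrow> \<eta> y \<in> V"
proof -
  obtain c where c: "c \<in> charts_at \<A> z" by (rule exists_chart_at[OF A])
  note ic = charts_atD(1)[OF c] and zc = charts_atD(2)[OF c]
  define f where "f = \<phi> \<circ> chart_inv c"
  define \<zeta> where "\<zeta> = snd c z"
  have K: "keller_C1_on (snd c ` fst c) f"
    using \<phi> charts_atD(3)[OF c] by (auto simp: C1_functional_def f_def)
  have \<zeta>: "\<zeta> \<in> snd c ` fst c" using zc by (simp add: \<zeta>_def)
  have "dir_deriv f \<zeta> \<noteq> (\<lambda>h. 0)"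
    using z c by (auto simp: critical_point_def f_def \<zeta>_def)
  then obtain h0 where h0: "dir_deriv f \<zeta> h0 \<noteq> 0" by blast
  obtain h where h: "dir_deriv f \<zeta> h < 0"
  proof (cases "dir_deriv f \<zeta> h0 < 0")
    case False
    then have "dir_deriv f \<zeta> (- h0) < 0"
      using h0 linear_neg[OF keller_C1_on_linear(1)[OF K \<zeta>], of h0] by simp
    then show ?thesis by (rule that)
  qed (rule that)
  define \<Omega> where "\<Omega> = {u \<in> snd c ` fst c. dir_deriv f u ` {h} \<subseteq> {..<0}} \<inter> snd c ` (V \<inter> fst c)"
  have "open \<Omega>"
    unfolding \<Omega>_def
    by (intro open_Int keller_C1_on_open_dir_deriv[OF K] chart_open_image[OF ic] V chart_open(1)[OF ic]) auto
  moreover have "\<zeta> \<in> \<Omega>" using h \<zeta> V zc by (auto simp: \<Omega>_def \<zeta>_def)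
  ultimately obtain q1 r1 where q1: "continuous_seminorm q1" "r1 > 0" "{u. q1 (u - \<zeta>) < r1} \<subseteq> \<Omega>"
    by (rule open_contains_seminorm_ball)
  have "open (fst c \<inter> snd c -` {u. q1 (u - \<zeta>) < r1})"
    by (rule chart_open_vimage[OF ic continuous_seminorm_ball[OF q1(1)]])
  moreover have "z \<in> fst c \<inter> snd c -` {u. q1 (u - \<zeta>) < r1}"
    using zc q1(2) seminorm_0[OF continuous_seminorm_imp[OF q1(1)]] by (simp add: \<zeta>_def)
  ultimately obtain B where B: "open B" "z \<in> B" "closure B \<subseteq> fst c \<inter> snd c -` {u. q1 (u - \<zeta>) < r1}"
    using reg by blast
  have Bc: "closure B \<subseteq> fst c" "B \<subseteq> fst c" using B(3) closure_subset[of B] by auto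
  have "open (snd c ` B)" "\<zeta> \<in> snd c ` B"
    using chart_open_image[OF ic B(1) Bc(2)] B(2) by (auto simp: \<zeta>_def)
  then obtain q2 r2 where q2: "continuous_seminorm q2" "r2 > 0" "{u. q2 (u - \<zeta>) < r2} \<subseteq> snd c ` B"
    by (rule open_contains_seminorm_ball)
  define q where "q u = max (q1 u) (q2 u)" for u
  define e where "e = min r1 r2"
  have cq: "continuous_seminorm q"
    unfolding q_def[abs_def] by (rule continuous_seminorm_max[OF q1(1) q2(1)])
  note sq = continuous_seminorm_imp[OF cq]
  have e: "e > 0" using q1(2) q2(2) by (simp add: e_def)
  have in\<Omega>: "u \<in> \<Omega>" if "q (u - \<zeta>) < e" for u
    using that q1(3) by (auto simp: q_def e_def)
  have inB: "u \<in> snd c ` B" if "q (u - \<zeta>) < e" for u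
    using that q2(3) by (auto simp: q_def e_def)
  \<comment> \<open>With this radius, a point at which the cutoff function is positive is moved by at most
    \<open>\<rho> * q h\<close> and so remains in the ball of radius \<open>e\<close>.\<close>
  define \<rho> where "\<rho> = e / (1 + q h)"
  have qh: "1 + q h > 0" using seminorm_ge0[OF sq, of h] by simp
  have \<rho>: "\<rho> > 0" "\<rho> * (1 + q h) = e" using e qh by (auto simp: \<rho>_def)
  have "\<rho> \<le> e" using \<rho> seminorm_ge0[OF sq, of h] mult_left_mono[of 1 "1 + q h" \<rho>] by simp
  define \<omega> where "\<omega> y = max 0 (\<rho> - q (snd c y - \<zeta>))" for y
  have \<omega>_pos: "\<omega> y > 0 \<longleftrightarrow> q (snd c y - \<zeta>) < \<rho>" for y by (auto simp: \<omega>_def)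
  have \<omega>_ge: "\<omega> y \<ge> 0" for y by (simp add: \<omega>_def)
  have seg: "snd c y + t *\<^sub>R h \<in> \<Omega>" if "\<omega> y > 0" "0 \<le> t" "t \<le> \<omega> y" for y t
  proof (rule in\<Omega>)
    have "t \<le> \<rho>" using that seminorm_ge0[OF sq, of "snd c y - \<zeta>"] by (simp add: \<omega>_def)
    have "q (snd c y + t *\<^sub>R h - \<zeta>) \<le> q (snd c y - \<zeta>) + q (t *\<^sub>R h)"
      using seminorm_add[OF sq, of "snd c y - \<zeta>" "t *\<^sub>R h"] by (simp add: algebra_simps)
    also have "q (t *\<^sub>R h) = t * q h" using that(2) by (simp add: seminorm_scaleR[OF sq])
    also have "\<dots> \<le> \<rho> * q h" by (rule mult_right_mono[OF \<open>t \<le> \<rho>\<close> seminorm_ge0[OF sq]])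
    also have "q (snd c y - \<zeta>) < \<rho>" using that(1) \<omega>_pos by simp
    finally show "q (snd c y + t *\<^sub>R h - \<zeta>) < e" using \<rho>(2) by (simp add: algebra_simps)
  qed
  have \<omega>_B: "y \<in> B" if "y \<in> fst c" "\<omega> y > 0" for y
  proof -
    have "q (snd c y - \<zeta>) < e" using that(2) \<omega>_pos \<open>\<rho> \<le> e\<close> by (meson less_le_trans)
    then obtain b where b: "b \<in> B" "snd c y = snd c b" using inB by blast
    then have "y = b" using Bc(2) by (intro chart_inj[OF ic that(1)]) auto
    then show ?thesis using \<open>b \<in> B\<close> by simp
  qed
  define \<eta> where "\<eta> y = (if y \<in> fst c then chart_inv c (snd c y + \<omega> y *\<^sub>R h) else y)" for y
  have \<eta>_id: "\<eta> y = y" if "\<omega> y = 0 \<or> y \<notin> B" for y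
  proof (cases "y \<in> fst c")
    case True
    then have "\<omega> y = 0" using that \<omega>_B[of y] \<omega>_ge[of y] by force
    then show ?thesis using chart_inv_left[OF ic True] by (simp add: \<eta>_def True)
  qed (simp add: \<eta>_def)
  have moved: "snd c y + \<omega> y *\<^sub>R h \<in> snd c ` fst c" if "y \<in> fst c" for y
  proof (cases "\<omega> y > 0")
    case True
    from seg[OF this \<omega>_ge order_refl] show ?thesis by (simp add: \<Omega>_def)
  next
    case False
    then have "\<omega> y = 0" using \<omega>_ge[of y] by simp
    then show ?thesis using that by simp
  qed
  have dec: "\<phi> (\<eta> y) < \<phi> y" if y: "y \<in> fst c" "\<omega> y > 0" for y
  proof -
    have "f (snd c y + \<omega> y *\<^sub>R h) < f (snd c y + 0 *\<^sub>R h)"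
    proof (rule DERIV_neg_imp_decreasing[OF y(2)])
      fix t assume t: "0 \<le> t" "t \<le> \<omega> y"
      let ?u = "snd c y + t *\<^sub>R h"
      have u: "?u \<in> snd c ` fst c" "dir_deriv f ?u h < 0"
        using seg[OF y(2) t] by (auto simp: \<Omega>_def)
      have "((\<lambda>s. (f (?u + s *\<^sub>R h) - f ?u) /\<^sub>R s) \<longlongrightarrow> dir_deriv f ?u h) (at 0)"
        using keller_C1_on_has_dir_deriv[OF K u(1), of h] by (simp only: has_dir_deriv_def)
      then have "DERIV (\<lambda>t. f (snd c y + t *\<^sub>R h)) t :> dir_deriv f ?u h"
        by (simp add: DERIV_def scaleR_add_left add.assoc divide_inverse mult.commute)
      then show "\<exists>d. DERIV (\<lambda>t. f (snd c y + t *\<^sub>R h)) t :> d \<and> d < 0" using u(2) by blast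
    qed
    then show ?thesis using y(1) chart_inv_left[OF ic y(1)] by (simp add: f_def \<eta>_def)
  qed
  have cont_c: "continuous_on (fst c) \<eta>"
  proof -
    have "continuous_on (fst c) (\<lambda>y. snd c y + \<omega> y *\<^sub>R h)"
      using chart_continuous(1)[OF ic] unfolding continuous_on_def \<omega>_def
      by (intro ballI frechet_tendsto_add frechet_tendsto_scaleR tendsto_const tendsto_max tendsto_diff
          tendsto_continuous_seminorm[OF _ cq] frechet_tendsto_diff) auto
    then have "continuous_on (fst c) (\<lambda>y. chart_inv c (snd c y + \<omega> y *\<^sub>R h))"
      by (rule continuous_on_compose2[OF chart_continuous(2)[OF ic]]) (use moved in blast)
    then show ?thesis by (simp add: \<eta>_def cong: continuous_on_cong)
  qed
  have cont_B: "continuous_on (- closure B) \<eta>"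
  proof -
    have "\<eta> y = y" if "y \<in> - closure B" for y
      using that closure_subset by (intro \<eta>_id) blast
    then show ?thesis by (intro continuous_on_eq[OF continuous_on_id]) simp
  qed
  have "continuous_on (fst c \<union> - closure B) \<eta>"
    by (rule continuous_on_open_Un[OF chart_open(1)[OF ic] _ cont_c cont_B]) (rule open_Compl[OF closed_closure])
  moreover have "fst c \<union> - closure B = UNIV" using Bc by blast
  ultimately have cont: "continuous_on UNIV \<eta>" by simp
  let ?S = "fst c \<inter> snd c -` {u. q (u - \<zeta>) < \<rho>}"
  show ?thesis
  proof (rule that[OF cont])
    show "open ?S" by (rule chart_open_vimage[OF ic continuous_seminorm_ball[OF cq]])
    show "z \<in> ?S" using zc \<rho>(1) seminorm_0[OF sq] by (simp add: \<zeta>_def)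
    show "\<phi> (\<eta> y) < \<phi> y" if "y \<in> ?S" for y
      using that \<omega>_pos by (intro dec) auto
    show "\<eta> y = y \<or> \<phi> (\<eta> y) < \<phi> y" for y
      using dec[of y] \<eta>_id[of y] \<omega>_ge[of y] Bc(2) by (metis in_mono less_eq_real_def)
    have BV: "B \<subseteq> V"
    proof
      fix y assume "y \<in> B"
      then have yc: "y \<in> fst c" and "q1 (snd c y - \<zeta>) < r1" using B(3) closure_subset by auto
      then have "snd c y \<in> snd c ` (V \<inter> fst c)" using q1(3) by (auto simp: \<Omega>_def)
      then obtain v where v: "v \<in> V" "v \<in> fst c" "snd c y = snd c v" by auto
      have "y = v" by (rule chart_inj[OF ic yc v(2,3)])
      then show "y \<in> V" using v(1) by simp
    qed
    show "\<eta> y = y" if "y \<notin> V" for y using that BV by (intro \<eta>_id) blast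
    show "\<eta> y \<in> V" if "y \<in> V" for y
    proof (cases "y \<in> fst c \<and> \<omega> y > 0")
      case True
      then have "snd c y + \<omega> y *\<^sub>R h \<in> snd c ` (V \<inter> fst c)"
        using seg[of y "\<omega> y"] by (auto simp: \<Omega>_def)
      then show ?thesis using True chart_inv_left[OF ic] by (auto simp: \<eta>_def)
    next
      case False
      then have "\<omega> y = 0 \<or> y \<notin> B" using \<omega>_ge[of y] Bc(2) by (cases "y \<in> fst c") auto
      then have "\<eta> y = y" by (rule \<eta>_id)
      then show ?thesis using that by simp
    qed
  qed
qed

section \<open>Paths in charts\<close>

lemma chart_path_neighbourhood:
  fixes \<A> :: "('m::topological_space, 'f::frechet_space) chart set" and x :: 'm
  assumes A: "C1_atlas \<A>" and V: "open V" "x \<in> V"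
  obtains W where "open W" "x \<in> W" "W \<subseteq> V" "\<And>y. y \<in> W \<Longrightarrow> path_component W x y"
proof -
  obtain c where c: "c \<in> charts_at \<A> x" by (rule exists_chart_at[OF A])
  note ic = charts_atD(1)[OF c] and xc = charts_atD(2)[OF c]
  have "open (snd c ` (V \<inter> fst c))" "snd c x \<in> snd c ` (V \<inter> fst c)"
    using V xc by (auto intro!: chart_open_image[OF ic] chart_open(1)[OF ic])
  then obtain q e where q: "continuous_seminorm q" "e > 0" "{u. q (u - snd c x) < e} \<subseteq> snd c ` (V \<inter> fst c)"
    by (rule open_contains_seminorm_ball)
  note sq = continuous_seminorm_imp[OF q(1)]
  define W where "W = fst c \<inter> snd c -` {u. q (u - snd c x) < e}"
  have inW: "chart_inv c u \<in> W" if "q (u - snd c x) < e" for u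
  proof -
    have "u \<in> snd c ` fst c" using q(3) that by blast
    then show ?thesis using chart_inv_right[OF ic] that by (simp add: W_def)
  qed
  show ?thesis
  proof (rule that)
    show "open W" unfolding W_def by (rule chart_open_vimage[OF ic continuous_seminorm_ball[OF q(1)]])
    show "x \<in> W" using xc q(2) seminorm_0[OF sq] by (simp add: W_def)
    show "W \<subseteq> V"
    proof
      fix y assume y: "y \<in> W"
      then have "snd c y \<in> snd c ` (V \<inter> fst c)" using q(3) by (auto simp: W_def)
      then obtain v where v: "v \<in> V" "v \<in> fst c" "snd c y = snd c v" by auto
      have "y = v" using y by (intro chart_inj[OF ic _ v(2,3)]) (simp add: W_def)
      then show "y \<in> V" using v(1) by simp
    qed
    fix y assume y: "y \<in> W"
    define g where "g t = chart_inv c (snd c x + t *\<^sub>R (snd c y - snd c x))" for t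
    have seg: "q (snd c x + t *\<^sub>R (snd c y - snd c x) - snd c x) < e" if "t \<in> {0..1}" for t
    proof -
      have "q (snd c x + t *\<^sub>R (snd c y - snd c x) - snd c x) = t * q (snd c y - snd c x)"
        using that by (simp add: seminorm_scaleR[OF sq])
      also have "\<dots> \<le> q (snd c y - snd c x)"
        using that seminorm_ge0[OF sq] by (simp add: mult_left_le_one_le)
      also have "\<dots> < e" using y by (simp add: W_def)
      finally show ?thesis .
    qed
    have "path g"
      unfolding path_def g_def
      by (rule continuous_on_compose2[OF chart_continuous(2)[OF ic] continuous_on_segment])
         (use seg q(3) in blast)
    moreover have "path_image g \<subseteq> W" using seg inW by (auto simp: path_image_def g_def)
    moreover have "pathstart g = x" "pathfinish g = y"
      using chart_inv_left[OF ic] xc y by (auto simp: pathstart_def pathfinish_def g_def W_def)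
    ultimately show "path_component W x y" unfolding path_component_def by blast
  qed
qed

lemma open_path_component_chart:
  fixes \<A> :: "('m::topological_space, 'f::frechet_space) chart set" and x :: 'm
  assumes A: "C1_atlas \<A>" and S: "open S"
  shows "open (path_component_set S x)"
proof (subst open_subopen, intro ballI)
  fix y assume "y \<in> path_component_set S x"
  then have xy: "path_component S x y" by simp
  then have "y \<in> S" by (rule path_component_mem)
  then obtain W where W: "open W" "y \<in> W" "W \<subseteq> S" "\<And>w. w \<in> W \<Longrightarrow> path_component W y w"
    using chart_path_neighbourhood[OF A S] by blast
  have "W \<subseteq> path_component_set S x"
    using path_component_trans[OF xy path_component_of_subset[OF W(3) W(4)]] by blast
  then show "\<exists>T. open T \<and> y \<in> T \<and> T \<subseteq> path_component_set S x" using W by blast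
qed

lemma closure_path_component_chart:
  fixes \<A> :: "('m::topological_space, 'f::frechet_space) chart set" and x :: 'm
  assumes A: "C1_atlas \<A>" and S: "open S" and y: "y \<in> closure (path_component_set S x)" "y \<in> S"
  shows "y \<in> path_component_set S x"
proof -
  obtain W where W: "open W" "y \<in> W" "W \<subseteq> S" "\<And>w. w \<in> W \<Longrightarrow> path_component W y w"
    using chart_path_neighbourhood[OF A S y(2)] by blast
  then obtain w where "w \<in> W" "path_component S x w"
    using y(1) unfolding closure_iff_nhds_not_empty by blast
  then show ?thesis
    using path_component_trans path_component_sym path_component_of_subset[OF W(3) W(4)] by blast
qed

lemma connected_manifold_path:
  fixes \<A> :: "('m::topological_space, 'f::frechet_space) chart set"
  assumes A: "C1_atlas \<A>" and conn: "connected (UNIV :: 'm set)"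
  obtains h where "path h" "pathstart h = (x::'m)" "pathfinish h = y"
proof -
  let ?C = "path_component_set UNIV x"
  have "closure ?C \<subseteq> ?C"
    using closure_path_component_chart[OF A open_UNIV] by blast
  then have "closed ?C" by (metis closure_subset subset_antisym closed_closure)
  moreover have "open ?C" by (rule open_path_component_chart[OF A open_UNIV])
  moreover have "x \<in> ?C" by (simp add: path_component_refl)
  ultimately have "?C = UNIV"
    using conn[unfolded connected_clopen, rule_format, of ?C] by auto
  then have "path_component UNIV x y" by blast
  then show ?thesis using that unfolding path_component_def by blast
qed

section \<open>The minimax principle\<close>

text \<open>
  Replacing \<open>U\<close> by its preimage under a local descent removes from the set
  \<open>{y \<in> frontier U. \<phi> y = c}\<close> all points at which the descent is strict: if \<open>y\<close> lies on the new
  frontier, then \<open>\<eta> z y\<close> lies on the old one, hence \<open>c \<le> \<phi> (\<eta> z y) \<le> \<phi> y\<close>, and \<open>\<phi> y = c\<close> forces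
  \<open>\<eta> z y = y\<close>.
\<close>

lemma finite_push:
  fixes \<phi> :: "'m::t2_space \<Rightarrow> real"
  assumes D: "finite D"
    and U: "open U" "x0 \<in> U" "x1 \<notin> closure U" "\<And>y. y \<in> frontier U \<Longrightarrow> c \<le> \<phi> y"
    and cont: "\<And>z. z \<in> D \<Longrightarrow> continuous_on UNIV (\<eta> z)"
    and le: "\<And>z y. z \<in> D \<Longrightarrow> \<eta> z y = y \<or> \<phi> (\<eta> z y) < \<phi> y"
    and less: "\<And>z y. z \<in> D \<Longrightarrow> y \<in> S z \<Longrightarrow> \<phi> (\<eta> z y) < \<phi> y"
    and fix0: "\<And>z. z \<in> D \<Longrightarrow> \<eta> z x0 = x0" and fix1: "\<And>z. z \<in> D \<Longrightarrow> \<eta> z x1 = x1"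
  shows "\<exists>U'. open U' \<and> x0 \<in> U' \<and> x1 \<notin> closure U' \<and> (\<forall>y\<in>frontier U'. c \<le> \<phi> y) \<and>
    {y \<in> frontier U'. \<phi> y = c} \<subseteq> {y \<in> frontier U. \<phi> y = c} - (\<Union>z\<in>D. S z)"
  using D cont le less fix0 fix1
proof induction
  case empty
  show ?case by (intro exI[of _ U]) (simp add: U)
next
  case (insert z D)
  have "\<exists>U'. open U' \<and> x0 \<in> U' \<and> x1 \<notin> closure U' \<and> (\<forall>y\<in>frontier U'. c \<le> \<phi> y) \<and>
    {y \<in> frontier U'. \<phi> y = c} \<subseteq> {y \<in> frontier U. \<phi> y = c} - (\<Union>z\<in>D. S z)"
    by (rule insert.IH) (rule insert.prems, simp_all)+
  then obtain U' where U': "open U'" "x0 \<in> U'" "x1 \<notin> closure U'" "\<forall>y\<in>frontier U'. c \<le> \<phi> y"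
    and K: "{y \<in> frontier U'. \<phi> y = c} \<subseteq> {y \<in> frontier U. \<phi> y = c} - (\<Union>z\<in>D. S z)"
    by blast
  have c: "continuous_on UNIV (\<eta> z)" and
    l: "\<And>y. \<eta> z y = y \<or> \<phi> (\<eta> z y) < \<phi> y" and
    ls: "\<And>y. y \<in> S z \<Longrightarrow> \<phi> (\<eta> z y) < \<phi> y" and f: "\<eta> z x0 = x0" "\<eta> z x1 = x1"
    using insert.prems by blast+
  define U2 where "U2 = \<eta> z -` U'"
  have o: "open U2" unfolding U2_def by (rule open_vimage[OF U'(1) c])
  have "closed (\<eta> z -` closure U')" by (rule closed_vimage[OF closed_closure c])
  moreover have "U2 \<subseteq> \<eta> z -` closure U'" unfolding U2_def using closure_subset by blast
  ultimately have cl: "closure U2 \<subseteq> \<eta> z -` closure U'" by (rule closure_minimal[rotated])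
  have fr: "\<eta> z y \<in> frontier U'" if "y \<in> frontier U2" for y
    using that cl U'(1) o by (auto simp: frontier_def interior_open U2_def)
  have ge2: "\<forall>y\<in>frontier U2. c \<le> \<phi> y"
  proof
    fix y assume y: "y \<in> frontier U2"
    show "c \<le> \<phi> y" using U'(4) fr[OF y] l[of y] by force
  qed
  have "{y \<in> frontier U2. \<phi> y = c} \<subseteq> {y \<in> frontier U'. \<phi> y = c} - S z"
  proof
    fix y assume "y \<in> {y \<in> frontier U2. \<phi> y = c}"
    then have y: "y \<in> frontier U2" "\<phi> y = c" by auto
    have ge: "\<phi> (\<eta> z y) \<ge> \<phi> y" using U'(4) fr[OF y(1)] y(2) by blast
    then have "\<eta> z y = y" using l[of y] by auto
    moreover have "y \<notin> S z" using ls[of y] ge by auto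
    ultimately show "y \<in> {y \<in> frontier U'. \<phi> y = c} - S z" using fr[OF y(1)] y(2) by simp
  qed
  then have "{y \<in> frontier U2. \<phi> y = c} \<subseteq> {y \<in> frontier U. \<phi> y = c} - (\<Union>z\<in>insert z D. S z)"
    using K by blast
  moreover have "x0 \<in> U2" "x1 \<notin> closure U2" using U' cl f by (auto simp: U2_def)
  ultimately show ?case using o ge2 by blast
qed

lemma path_crosses_frontier:
  assumes h: "path h" "pathstart h = x0" "pathfinish h = x1" and U: "x0 \<in> U" "x1 \<notin> closure U"
  shows "\<exists>t\<in>{0..1}. h t \<in> frontier U"
proof -
  have "path_image h \<inter> frontier U \<noteq> {}"
  proof (rule connected_Int_frontier[OF connected_path_image[OF h(1)]])
    show "path_image h \<inter> U \<noteq> {}" using h(2) U(1) pathstart_in_path_image by blast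
    show "path_image h - U \<noteq> {}" using h(3) U(2) pathfinish_in_path_image closure_subset by blast
  qed
  then show ?thesis unfolding path_image_def by blast
qed

text \<open>
  The last assumption says that \<open>c\<close> is an upper bound of all levels which every path from
  \<open>x0\<close> to \<open>x1\<close> has to reach.
\<close>

lemma minimax_critical_point:
  fixes \<A> :: "('m::{t2_space, second_countable_topology}, 'f::frechet_space) chart set"
  assumes A: "C1_atlas \<A>"
    and reg: "\<And>V x::'m. open V \<Longrightarrow> x \<in> V \<Longrightarrow> \<exists>B. open B \<and> x \<in> B \<and> closure B \<subseteq> V"
    and \<phi>: "C1_functional \<A> \<phi>" and cl: "closed_map euclidean euclidean \<phi>"
    and U: "open U" "x0 \<in> U" "x1 \<notin> closure U" and ge: "\<And>y. y \<in> frontier U \<Longrightarrow> c \<le> \<phi> y"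
    and inf: "\<And>a. (\<And>h. path h \<Longrightarrow> pathstart h = x0 \<Longrightarrow> pathfinish h = x1 \<Longrightarrow> \<exists>t\<in>{0..1}. a \<le> \<phi> (h t)) \<Longrightarrow> a \<le> c"
  shows "\<exists>z\<in>frontier U. \<phi> z = c \<and> critical_point \<A> \<phi> z"
proof (rule ccontr)
  assume neg: "\<not> (\<exists>z\<in>frontier U. \<phi> z = c \<and> critical_point \<A> \<phi> z)"
  have cont: "continuous_on UNIV \<phi>" by (rule C1_functional_continuous[OF A \<phi>])
  define K where "K = {y \<in> frontier U. \<phi> y = c}"
  have ends: "x0 \<notin> frontier U" "x1 \<notin> frontier U"
    using U by (auto simp: frontier_def interior_open)
  have push: "\<exists>\<eta> S. continuous_on UNIV \<eta> \<and> open S \<and> z \<in> S \<and>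
    (\<forall>y. \<eta> y = y \<or> \<phi> (\<eta> y) < \<phi> y) \<and> (\<forall>y\<in>S. \<phi> (\<eta> y) < \<phi> y) \<and>
    (\<forall>y. y \<notin> V \<longrightarrow> \<eta> y = y) \<and> (\<forall>y\<in>V. \<eta> y \<in> V)" if z: "z \<in> K" and V: "open V" "z \<in> V" for z V
  proof -
    have nc: "\<not> critical_point \<A> \<phi> z" using neg z by (auto simp: K_def)
    show ?thesis by (rule descending_push[OF A reg \<phi> nc V]) blast+
  qed
  have "compact K"
  proof (rule compact_fibre_part[OF reg cont cl])
    have "K = frontier U \<inter> \<phi> -` {c}" by (auto simp: K_def)
    then show "closed K"
      using closed_Int[OF frontier_closed[of U] closed_vimage[OF closed_singleton[of c] cont]] by simp
    show "\<phi> z = c" if "z \<in> K" for z using that by (simp add: K_def)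
    show "z \<in> closure {y. \<phi> y \<noteq> c}" if z: "z \<in> K" for z
      unfolding closure_iff_nhds_not_empty
    proof (intro allI impI)
      fix W V assume W: "W \<subseteq> V" "open W" "z \<in> W"
      \<comment> \<open>a local descent supported in \<open>W\<close> moves \<open>z\<close> to a point of \<open>W\<close> at a lower level\<close>
      obtain \<eta> where "\<phi> (\<eta> z) < \<phi> z" "\<eta> z \<in> W" using push[OF z W(2,3)] W(3) by blast
      moreover have "\<phi> z = c" using z by (simp add: K_def)
      ultimately have "\<eta> z \<in> {y. \<phi> y \<noteq> c} \<inter> V" using W(1) by auto
      then show "{y. \<phi> y \<noteq> c} \<inter> V \<noteq> {}" by blast
    qed
  qed
  let ?V = "- {x0, x1}"
  have oV: "open ?V" by (intro open_Compl finite_imp_closed) simp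
  have "\<forall>z\<in>K. \<exists>p. continuous_on UNIV (fst p) \<and> open (snd p) \<and> z \<in> snd p \<and>
    (\<forall>y. fst p y = y \<or> \<phi> (fst p y) < \<phi> y) \<and> (\<forall>y\<in>snd p. \<phi> (fst p y) < \<phi> y) \<and>
    fst p x0 = x0 \<and> fst p x1 = x1"
  proof
    fix z assume z: "z \<in> K"
    then have "z \<in> ?V" using ends by (auto simp: K_def)
    from push[OF z oV this] obtain \<eta> S where "continuous_on UNIV \<eta>" "open S" "z \<in> S"
      "\<forall>y. \<eta> y = y \<or> \<phi> (\<eta> y) < \<phi> y" "\<forall>y\<in>S. \<phi> (\<eta> y) < \<phi> y" "\<forall>y. y \<notin> ?V \<longrightarrow> \<eta> y = y" by blast
    then show "\<exists>p. continuous_on UNIV (fst p) \<and> open (snd p) \<and> z \<in> snd p \<and>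
      (\<forall>y. fst p y = y \<or> \<phi> (fst p y) < \<phi> y) \<and> (\<forall>y\<in>snd p. \<phi> (fst p y) < \<phi> y) \<and>
      fst p x0 = x0 \<and> fst p x1 = x1"
      by (intro exI[of _ "(\<eta>, S)"]) simp
  qed
  from bchoice[OF this] obtain p where p: "\<And>z. z \<in> K \<Longrightarrow> continuous_on UNIV (fst (p z))"
    "\<And>z. z \<in> K \<Longrightarrow> open (snd (p z))" "\<And>z. z \<in> K \<Longrightarrow> z \<in> snd (p z)"
    "\<And>z y. z \<in> K \<Longrightarrow> fst (p z) y = y \<or> \<phi> (fst (p z) y) < \<phi> y"
    "\<And>z y. z \<in> K \<Longrightarrow> y \<in> snd (p z) \<Longrightarrow> \<phi> (fst (p z) y) < \<phi> y"
    "\<And>z. z \<in> K \<Longrightarrow> fst (p z) x0 = x0" "\<And>z. z \<in> K \<Longrightarrow> fst (p z) x1 = x1"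
    by blast
  have cover: "K \<subseteq> (\<Union>z\<in>K. snd (p z))" using p(3) by auto
  obtain D where D: "D \<subseteq> K" "finite D" "K \<subseteq> (\<Union>z\<in>D. snd (p z))"
    by (rule compactE_image[OF \<open>compact K\<close> p(2) cover])
  have DK: "z \<in> K" if "z \<in> D" for z using D(1) that by blast
  have "\<exists>U'. open U' \<and> x0 \<in> U' \<and> x1 \<notin> closure U' \<and> (\<forall>y\<in>frontier U'. c \<le> \<phi> y) \<and>
    {y \<in> frontier U'. \<phi> y = c} \<subseteq> {y \<in> frontier U. \<phi> y = c} - (\<Union>z\<in>D. snd (p z))"
    by (rule finite_push[OF D(2) U ge p(1)[OF DK] p(4)[OF DK] p(5)[OF DK] p(6)[OF DK] p(7)[OF DK]])
  then obtain U' where U': "open U'" "x0 \<in> U'" "x1 \<notin> closure U'" "\<And>y. y \<in> frontier U' \<Longrightarrow> c \<le> \<phi> y"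
    and K': "{y \<in> frontier U'. \<phi> y = c} \<subseteq> K - (\<Union>z\<in>D. snd (p z))"
    unfolding K_def by blast
  have "c \<notin> \<phi> ` frontier U'" using K' D(3) by blast
  moreover have "closed (\<phi> ` frontier U')"
    using cl frontier_closed[of U'] by (simp add: closed_map_def)
  ultimately obtain \<delta> where \<delta>: "\<delta> > 0" "\<And>v. dist v c < \<delta> \<Longrightarrow> v \<notin> \<phi> ` frontier U'"
    unfolding closed_def open_dist by (meson ComplD ComplI)
  have far: "c + \<delta> \<le> \<phi> y" if "y \<in> frontier U'" for y
    using \<delta>(2)[of "\<phi> y"] U'(4)[OF that] that by (force simp: dist_real_def)
  have "c + \<delta> \<le> c"
  proof (rule inf)
    fix h assume "path h" "pathstart h = x0" "pathfinish h = x1"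
    from path_crosses_frontier[OF this U'(2,3)]
    show "\<exists>t\<in>{0..1}. c + \<delta> \<le> \<phi> (h t)" using far by blast
  qed
  then show False using \<delta>(1) by simp
qed

theorem theorem3p2:
  fixes \<A> :: "('m::{t2_space, second_countable_topology}, 'f::frechet_space) chart set"
    and N :: "nat \<Rightarrow> 'm \<times> ('m, 'f) tvec \<Rightarrow> real"
    and \<phi> :: "'m \<Rightarrow> real" and x0 x1 :: 'm and U :: "'m set"
    and i :: ereal and c :: real
  assumes "C1_atlas \<A>" and "connected (UNIV :: 'm set)"
    and "finsler_structure \<A> N"
    and "Metric_space.mcomplete UNIV (finsler_metric \<A> N)"
    and "open U" and "x0 \<in> U" and "x1 \<notin> closure U"
    and "C1_functional \<A> \<phi>" and "\<not> \<phi> constant_on UNIV"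
    and "closed_map euclidean euclidean \<phi>"
    and i_def: "i = (INF x\<in>frontier U. ereal (\<phi> x))"
    and "ereal (max (\<phi> x0) (\<phi> x1)) \<le> i"
    and c_def: "c = (INF h\<in>{h. path h \<and> pathstart h = x0 \<and> pathfinish h = x1}.
                       SUP t\<in>{0..1}. \<phi> (h t))"
    and "palais_smale \<A> N \<phi> c UNIV"
  shows "critical_value \<A> \<phi> c \<and> ereal c \<ge> i \<and>
         (ereal c = i \<longrightarrow> Cr \<A> \<phi> c \<inter> frontier U \<noteq> {})"
proof -
  note A = assms(1) and conn = assms(2) and F = assms(3) and U = assms(5-7) and \<phi> = assms(8)
    and cl = assms(10)
  have ends: "ereal (\<phi> x0) \<le> i" "ereal (\<phi> x1) \<le> i"
    by (rule order_trans[OF _ assms(12)], simp del: ereal_max)+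
  have reg: "\<exists>B. open B \<and> x \<in> B \<and> closure B \<subseteq> V" if "open V" "x \<in> V" for V and x :: 'm
    by (rule finsler_regular[OF A F that]) blast
  have cont: "continuous_on UNIV \<phi>" by (rule C1_functional_continuous[OF A \<phi>])
  define \<P> where "\<P> = {h. path h \<and> pathstart h = x0 \<and> pathfinish h = x1}"
  define s where "s h = (SUP t\<in>{0..1}. \<phi> (h t))" for h :: "real \<Rightarrow> 'm"
  have c: "c = (INF h\<in>\<P>. s h)" using c_def by (simp add: \<P>_def s_def)
  have ne: "\<P> \<noteq> {}"
  proof -
    obtain h where "path h" "pathstart h = x0" "pathfinish h = x1"
      by (rule connected_manifold_path[OF A conn])
    then show ?thesis by (auto simp: \<P>_def)
  qed
  have att: "\<exists>t\<in>{0..1}. \<forall>r\<in>{0..1}. \<phi> (h r) \<le> \<phi> (h t)" if "h \<in> \<P>" for h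
  proof (rule continuous_attains_sup)
    show "continuous_on {0..1} (\<lambda>t. \<phi> (h t))"
      using that by (intro continuous_on_compose2[OF cont]) (auto simp: \<P>_def path_def)
  qed auto
  have s_ge: "\<phi> (h t) \<le> s h" if ht: "h \<in> \<P>" "t \<in> {0..1}" for h t
  proof -
    obtain t0 where "\<forall>r\<in>{0..1}. \<phi> (h r) \<le> \<phi> (h t0)" using att[OF ht(1)] by blast
    then have "bdd_above ((\<lambda>t. \<phi> (h t)) ` {0..1})" by (intro bdd_aboveI2) blast
    then show ?thesis unfolding s_def using ht(2) by (intro cSUP_upper)
  qed
  have s_at: "\<exists>t\<in>{0..1}. s h = \<phi> (h t)" if h: "h \<in> \<P>" for h
  proof -
    obtain t where t: "t \<in> {0..1}" "\<forall>r\<in>{0..1}. \<phi> (h r) \<le> \<phi> (h t)" using att[OF h] by blast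
    have "s h \<le> \<phi> (h t)" unfolding s_def by (rule cSUP_least) (use t in auto)
    then show ?thesis using s_ge[OF h t(1)] t(1) by (intro bexI[of _ t]) auto
  qed
  have inf: "a \<le> c" if a: "\<And>h. path h \<Longrightarrow> pathstart h = x0 \<Longrightarrow> pathfinish h = x1 \<Longrightarrow> \<exists>t\<in>{0..1}. a \<le> \<phi> (h t)" for a
    unfolding c
  proof (rule cINF_greatest[OF ne])
    fix h assume h: "h \<in> \<P>"
    then have "path h" "pathstart h = x0" "pathfinish h = x1" by (simp_all add: \<P>_def)
    from a[OF this] obtain t where "t \<in> {0..1}" "a \<le> \<phi> (h t)" by blast
    then show "a \<le> s h" using s_ge[OF h] order_trans by blast
  qed
  have bdd: "bdd_below (s ` \<P>)"
  proof (rule bdd_belowI2)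
    fix h assume "h \<in> \<P>"
    then show "\<phi> x0 \<le> s h" using s_ge[of h 0] by (simp add: \<P>_def pathstart_def)
  qed
  have c_le: "\<exists>t\<in>{0..1}. c \<le> \<phi> (h t)" if "path h" "pathstart h = x0" "pathfinish h = x1" for h
  proof -
    have h: "h \<in> \<P>" using that by (simp add: \<P>_def)
    have "c \<le> s h" unfolding c by (rule cINF_lower[OF bdd h])
    then show ?thesis using s_at[OF h] by auto
  qed
  note cross = path_crosses_frontier[OF _ _ _ U(2,3)]
  have i_le: "i \<le> ereal (\<phi> y)" if "y \<in> frontier U" for y
    unfolding i_def using that by (rule INF_lower)
  obtain y0 where "y0 \<in> frontier U"
    using ne cross by (auto simp: \<P>_def)
  then obtain i' where i': "i = ereal i'"
    using i_le[of y0] ends(1) by (cases i) auto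
  have ge: "i' \<le> c"
  proof (rule inf)
    fix h assume "path h" "pathstart h = x0" "pathfinish h = x1"
    then obtain t where "t \<in> {0..1}" "h t \<in> frontier U" using cross by blast
    moreover from this have "i' \<le> \<phi> (h t)" using i_le[of "h t"] i' by simp
    ultimately show "\<exists>t\<in>{0..1}. i' \<le> \<phi> (h t)" by blast
  qed
  have eq: "\<exists>z\<in>frontier U. \<phi> z = c \<and> critical_point \<A> \<phi> z" if "c = i'"
    using i_le that i' by (intro minimax_critical_point[OF A reg \<phi> cl U _ inf]) auto
  have "\<exists>z. \<phi> z = c \<and> critical_point \<A> \<phi> z"
  proof (cases "c = i'")
    case True
    then show ?thesis using eq by blast
  next
    case False
    then have "i' < c" using ge by simp
    then have low: "\<phi> x0 < c" "\<phi> x1 < c" using ends i' by auto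
    \<comment> \<open>the given \<open>U\<close> is replaced by the path component of \<open>x0\<close> in the sublevel set\<close>
    define L where "L = {y. \<phi> y < c}"
    have oL: "open L"
      using open_vimage[OF open_lessThan[of c] cont] by (simp add: L_def vimage_def)
    define C where "C = path_component_set L x0"
    have oC: "open C" unfolding C_def by (rule open_path_component_chart[OF A oL])
    have x0C: "x0 \<in> C" using low by (simp add: C_def L_def path_component_refl)
    have clC: "y \<in> C" if "y \<in> closure C" "y \<in> L" for y
      using closure_path_component_chart[OF A oL] that by (simp add: C_def)
    have "x1 \<notin> closure C"
    proof
      assume "x1 \<in> closure C"
      then have "path_component L x0 x1" using clC low by (simp add: L_def C_def)
      then obtain h where h: "path h" "path_image h \<subseteq> L" "pathstart h = x0" "pathfinish h = x1"
        unfolding path_component_def by blast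
      then show False using c_le[OF h(1,3,4)] by (force simp: path_image_def L_def)
    qed
    moreover have "c \<le> \<phi> y" if "y \<in> frontier C" for y
      using that clC[of y] oC by (force simp: frontier_def interior_open L_def)
    ultimately show ?thesis
      using minimax_critical_point[OF A reg \<phi> cl oC x0C _ _ inf] by blast
  qed
  then show ?thesis
    using ge eq i' by (auto simp: critical_value_def Cr_def)
qed

end
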